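(* An orthogonal basis for $V_n$ (with respect to $\langle\cdot,\cdot\rangle_{\rm cher}$) is $\{X_0,X_{-1},X_1,\dots,X_{-n},X_n\}$, where $$X_{-m}=(1-t_1t_2)(1-t_1t_3)(1-t_1t_4)R_m-t_1(1-t_1t_2t_3t_4q^{m-1})S_m\quad(m>0),$$ $$X_{m}=(1-t_1t_2)(1-t_1t_3)(1-t_1t_4)R_m+t_1^2t_2(1-q^{m})S_m\quad(m\ge0).$$
   Context: Standing assumptions: $0<q<1$; $\mathbf t=(t_1,t_2,t_3,t_4)$ with each $t_i$ real and $|t_i|<1$; $n\ge0$ is an integer. Notation: $(a;q)_k=\prod_{i=0}^{k-1}(1-aq^i)$, $(a;q)_\infty=\prod_{i\ge0}(1-aq^i)$, $(a_1,\dots,a_r;q)_k=\prod_j(a_j;q)_k$, and ${}_4\phi_3(a_1,a_2,a_3,a_4;b_1,b_2,b_3;q,q)=\sum_{k\ge 0}\frac{(a_1,a_2,a_3,a_4;q)_k}{(q,b_1,b_2,b_3;q)_k}q^k$. $V_n$ is the $(2n+1)$-dimensional real vector space of Laurent polynomials spanned by $z^{-n},z^{1-n},\dots,z^{n}$. $R_n=R_n(z;\mathbf t\,|\,q)={}_4\phi_3(q^{-n},t_1t_2t_3t_4q^{n-1},t_1z,t_1/z;\;t_1t_2,t_1t_3,t_1t_4;q,q)$ for $n\ge0$. $S_0=0$ and for $n\ge1$, $S_n=S_n(z;\mathbf t\,|\,q)=z(1-t_3/z)(1-t_4/z)\;{}_4\phi_3(q^{1-n},t_1t_2t_3t_4q^{n},t_1z,qt_1/z;\;qt_1t_2,qt_1t_3,qt_1t_4;q,q)$.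 $w_{\rm cher}(z;\mathbf t\,|\,q)=\dfrac{(q,z^2,qz^{-2};q)_\infty}{\prod_{j=1}^4(t_jz;q)_\infty\,(t_3/z,t_4/z,qt_1/z,qt_2/z;q)_\infty}$ and, for Laurent polynomials $f,g$, $\langle f,g\rangle_{\rm cher}=\frac1{2\pi i}\oint_{|z|=1}f(z)g(z)\,w_{\rm cher}(z;\mathbf t\,|\,q)\,\frac{dz}{z}$. "Orthogonal basis" means a basis whose distinct elements are pairwise orthogonal for this form.
   Formalization: The basis claim is proved when t_1≠0 and 1-t_1t_2t_3t_4q^{m-1}+t_1t_2(1-q^m)≠0 for 1≤m≤n; otherwise X_m=X_{-m} for some m≥1 and the set is not a basis. Orthogonality and membership in V_n are proved for all parameters. *)

theory Defs
  imports "HOL-Complex_Analysis.Complex_Analysis" "HOL-Library.Function_Algebras"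
begin

definition qpoch :: "complex \<Rightarrow> complex \<Rightarrow> nat \<Rightarrow> complex" where
  "qpoch a q k = (\<Prod>i<k. 1 - a * q ^ i)"

definition qpoch_inf :: "complex \<Rightarrow> complex \<Rightarrow> complex" where
  "qpoch_inf a q = (\<Prod>i. 1 - a * q ^ i)"

text \<open>The basic hypergeometric series with four upper and three lower parameters, base \<open>q\<close> and
  argument \<open>x\<close>.  Below, the first upper parameter is always a nonpositive integer power of
  \<open>q\<close>, so that all but finitely many terms vanish.\<close>
definition phi43 ::
  "complex \<Rightarrow> complex \<Rightarrow> complex \<Rightarrow> complex \<Rightarrow> complex \<Rightarrow> complex \<Rightarrow> complex \<Rightarrow> complex \<Rightarrow> complex \<Rightarrow> complex"
  where
  "phi43 a1 a2 a3 a4 b1 b2 b3 q x =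
     (\<Sum>k. qpoch a1 q k * qpoch a2 q k * qpoch a3 q k * qpoch a4 q k
           / (qpoch q q k * qpoch b1 q k * qpoch b2 q k * qpoch b3 q k) * x ^ k)"

definition AW_R :: "real \<Rightarrow> real \<Rightarrow> real \<Rightarrow> real \<Rightarrow> real \<Rightarrow> nat \<Rightarrow> complex \<Rightarrow> complex" where
  "AW_R t1 t2 t3 t4 q n z =
     phi43 (of_real (q powi (- int n))) (of_real (t1 * t2 * t3 * t4 * q powi (int n - 1)))
           (of_real t1 * z) (of_real t1 / z)
           (of_real (t1 * t2)) (of_real (t1 * t3)) (of_real (t1 * t4))
           (of_real q) (of_real q)"

definition AW_S :: "real \<Rightarrow> real \<Rightarrow> real \<Rightarrow> real \<Rightarrow> real \<Rightarrow> nat \<Rightarrow> complex \<Rightarrow> complex" where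
  "AW_S t1 t2 t3 t4 q n z =
     (if n = 0 then 0
      else z * (1 - of_real t3 / z) * (1 - of_real t4 / z) *
        phi43 (of_real (q powi (1 - int n))) (of_real (t1 * t2 * t3 * t4 * q ^ n))
              (of_real t1 * z) (of_real (q * t1) / z)
              (of_real (q * t1 * t2)) (of_real (q * t1 * t3)) (of_real (q * t1 * t4))
              (of_real q) (of_real q))"

text \<open>Laurent polynomials are regarded as functions on the punctured plane.  Since HOL functions
  are total, such a function is extended by \<open>0\<close> at the origin, so that equality of functions is
  equality on the punctured plane.\<close>
definition punctured :: "(complex \<Rightarrow> complex) \<Rightarrow> complex \<Rightarrow> complex" where
  "punctured f = (\<lambda>z. if z = 0 then 0 else f z)"

definition fun_scale :: "real \<Rightarrow> (complex \<Rightarrow> complex) \<Rightarrow> complex \<Rightarrow> complex" where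
  "fun_scale c f = (\<lambda>z. c *\<^sub>R f z)"

text \<open>The real vector space of all functions from \<open>\<complex>\<close> to \<open>\<complex>\<close> with pointwise operations; it
  provides \<open>fun_vs.span\<close> and \<open>fun_vs.independent\<close>.\<close>
global_interpretation fun_vs: vector_space fun_scale
  by unfold_locales (auto simp: fun_scale_def fun_eq_iff scaleR_add_right scaleR_add_left)

definition laurent_space :: "nat \<Rightarrow> (complex \<Rightarrow> complex) set" where
  "laurent_space n = fun_vs.span ((\<lambda>k. punctured (\<lambda>z. z powi k)) ` {- int n..int n})"

definition w_cher :: "real \<Rightarrow> real \<Rightarrow> real \<Rightarrow> real \<Rightarrow> real \<Rightarrow> complex \<Rightarrow> complex" where
  "w_cher t1 t2 t3 t4 q z =
     (let P = (\<lambda>a. qpoch_inf a (of_real q)) in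
      P (of_real q) * P (z ^ 2) * P (of_real q * z powi (-2))
      / (P (of_real t1 * z) * P (of_real t2 * z) * P (of_real t3 * z) * P (of_real t4 * z)
         * P (of_real t3 / z) * P (of_real t4 / z)
         * P (of_real (q * t1) / z) * P (of_real (q * t2) / z)))"

definition cher_form ::
  "real \<Rightarrow> real \<Rightarrow> real \<Rightarrow> real \<Rightarrow> real \<Rightarrow> (complex \<Rightarrow> complex) \<Rightarrow> (complex \<Rightarrow> complex) \<Rightarrow> complex" where
  "cher_form t1 t2 t3 t4 q f g =
     1 / (2 * of_real pi * \<i>) *
     contour_integral (circlepath 0 1) (\<lambda>z. f z * g z * w_cher t1 t2 t3 t4 q z / z)"

text \<open>One family indexed by the integers: a negative index \<open>-m\<close> gives the first of the two kinds
  of elements, a nonnegative index \<open>m\<close> the second.\<close>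
definition cher_X :: "real \<Rightarrow> real \<Rightarrow> real \<Rightarrow> real \<Rightarrow> real \<Rightarrow> int \<Rightarrow> complex \<Rightarrow> complex" where
  "cher_X t1 t2 t3 t4 q j =
     (let m = nat \<bar>j\<bar> in
      punctured (\<lambda>z.
        if j < 0 then
          of_real ((1 - t1 * t2) * (1 - t1 * t3) * (1 - t1 * t4)) * AW_R t1 t2 t3 t4 q m z
          - of_real (t1 * (1 - t1 * t2 * t3 * t4 * q ^ (m - 1))) * AW_S t1 t2 t3 t4 q m z
        else
          of_real ((1 - t1 * t2) * (1 - t1 * t3) * (1 - t1 * t4)) * AW_R t1 t2 t3 t4 q m z
          + of_real (t1 ^ 2 * t2 * (1 - q ^ m)) * AW_S t1 t2 t3 t4 q m z))"

definition pairwise_orthogonal ::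
  "((complex \<Rightarrow> complex) \<Rightarrow> (complex \<Rightarrow> complex) \<Rightarrow> complex) \<Rightarrow> 'i set \<Rightarrow> ('i \<Rightarrow> complex \<Rightarrow> complex) \<Rightarrow> bool"
  where
  "pairwise_orthogonal B I x \<longleftrightarrow> (\<forall>i\<in>I. \<forall>j\<in>I. i \<noteq> j \<longrightarrow> B (x i) (x j) = 0)"

definition orthogonal_basis ::
  "((complex \<Rightarrow> complex) \<Rightarrow> (complex \<Rightarrow> complex) \<Rightarrow> complex) \<Rightarrow> (complex \<Rightarrow> complex) set
    \<Rightarrow> 'i set \<Rightarrow> ('i \<Rightarrow> complex \<Rightarrow> complex) \<Rightarrow> bool"
  where
  "orthogonal_basis B V I x \<longleftrightarrow>
     inj_on x I \<and> fun_vs.independent (x ` I) \<and> fun_vs.span (x ` I) = V \<and> pairwise_orthogonal B I x"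

text \<open>Without this condition the family is not a basis.  The difference of the elements with
  indices \<open>m\<close> and \<open>-m\<close> is
  \<open>t1 * (1 - t1 * t2 * t3 * t4 * q ^ (m - 1) + t1 * t2 * (1 - q ^ m))\<close> times \<open>S\<^sub>m\<close>, so the two
  elements coincide when \<open>t1 = 0\<close> or the second factor vanishes.  The latter can happen inside
  the parameter range, e.g. for \<open>m = 1\<close>, \<open>q = 1/30\<close>, \<open>t1 * t2 = -3/5\<close>,
  \<open>t3 * t4 = -7/10\<close>.\<close>
definition nondegenerate :: "real \<Rightarrow> real \<Rightarrow> real \<Rightarrow> real \<Rightarrow> real \<Rightarrow> nat \<Rightarrow> bool" where
  "nondegenerate t1 t2 t3 t4 q n \<longleftrightarrow>
     (\<forall>m\<in>{1..n}. t1 \<noteq> 0 \<and> 1 - t1 * t2 * t3 * t4 * q ^ (m - 1) + t1 * t2 * (1 - q ^ m) \<noteq> 0)"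

end

theory Submission
  imports Defs
begin

text \<open>Write \<open>\<langle>f, g\<rangle>\<close> for the form, \<open>h\<^sub>m\<^sub>n\<close> for the Askey--Wilson pairing of \<open>R\<^sub>m\<close> and \<open>R\<^sub>n\<close>, and
  \<open>h'\<^sub>m\<^sub>n\<close> for the same pairing with all parameters multiplied by \<open>q\<^bsup>1/2\<^esup>\<close>.
  Up to the factor \<open>z (1 - t\<^sub>3/z) (1 - t\<^sub>4/z)\<close>, \<open>S\<^sub>n(z)\<close> is \<open>R\<^sub>n\<^sub>-\<^sub>1(z/q\<^bsup>1/2\<^esup>)\<close> with these shifted
  parameters.  Symmetrising the integrand under \<open>z \<mapsto> 1/z\<close> expresses \<open>\<langle>R\<^sub>m, R\<^sub>n\<rangle>\<close> and, by the
  raising relation, \<open>\<langle>R\<^sub>m, S\<^sub>n\<rangle>\<close> as multiples of \<open>h\<^sub>m\<^sub>n\<close>.  Moving the contour to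
  \<open>|z| = q\<^bsup>1/2\<^esup>\<close> and symmetrising under \<open>z \<mapsto> q/z\<close> instead expresses \<open>\<langle>S\<^sub>m, S\<^sub>n\<rangle>\<close> and, by the
  lowering relation, \<open>\<langle>R\<^sub>m, S\<^sub>n\<rangle>\<close> as multiples of \<open>h'\<close> with both indices decreased by one.
  Comparing the two values of \<open>\<langle>R\<^sub>m, S\<^sub>n\<rangle>\<close> gives \<open>h\<^sub>m\<^sub>n = 0\<close> for \<open>m \<noteq> n\<close> by induction, and for
  \<open>m = n\<close> it turns \<open>\<langle>X\<^sub>m, X\<^sub>-\<^sub>m\<rangle> = 0\<close> into an identity between coefficients, so that no norm
  has to be computed.  Spanning follows from the coefficients of \<open>z\<^sup>m\<close> and \<open>z\<^sup>-\<^sup>m\<close>, which are in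
  ratio \<open>1\<close> for \<open>R\<^sub>m\<close> and \<open>t\<^sub>3 t\<^sub>4 q\<^bsup>m-1\<^esup> \<noteq> 1\<close> for \<open>S\<^sub>m\<close>.\<close>

section \<open>Infinite products and circle means\<close>

lemma convergent_prod_qpoch_inf:
  assumes "norm q < 1"
  shows "convergent_prod (\<lambda>i. 1 - a * q ^ i :: complex)"
proof -
  have "summable (\<lambda>i. norm a * norm q ^ i)"
    using assms by (intro summable_mult summable_geometric) auto
  then have "abs_convergent_prod (\<lambda>i. 1 + - (a * q ^ i))"
    by (simp add: abs_convergent_prod_conv_summable norm_mult norm_power)
  then show ?thesis
    using abs_convergent_prod_imp_convergent_prod by auto
qed

lemma qpoch_inf_step:
  assumes "norm q < 1"
  shows "qpoch_inf a q = (1 - a) * qpoch_inf (q * a) q"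
proof -
  have "(\<lambda>i. 1 - a * q ^ i) has_prod ((\<Prod>k<1. 1 - a * q ^ k) * (\<Prod>k. 1 - a * q ^ (k + 1)))"
    by (intro has_prod_ignore_initial_segment' convergent_prod_qpoch_inf assms)
  then show ?thesis
    unfolding qpoch_inf_def by (simp add: has_prod_unique [symmetric] mult_ac)
qed

lemma one_minus_mult_power_nonzero:
  fixes a q :: complex
  assumes "norm q < 1" "norm a < 1"
  shows "1 - a * q ^ i \<noteq> 0"
proof -
  have "norm (a * q ^ i) \<le> norm a * 1"
    unfolding norm_mult norm_power using assms
    by (intro mult_left_mono power_le_one) auto
  with assms(2) show ?thesis
    by (metis eq_iff_diff_eq_0 mult.right_neutral norm_one not_le)
qed

lemma qpoch_inf_nonzero:
  assumes "norm q < 1" "norm a < 1"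
  shows "qpoch_inf a q \<noteq> 0"
  unfolding qpoch_inf_def
  by (rule prodinf_nonzero [OF convergent_prod_qpoch_inf [OF assms(1)]
        one_minus_mult_power_nonzero [OF assms]])

text \<open>The partial products are polynomials in \<open>a\<close> and converge uniformly on every
  closed unit disc, by the M-test with majorant \<open>(norm x + 1) * norm q ^ i\<close>.\<close>

lemma holomorphic_qpoch_inf:
  assumes q: "norm q < 1"
  shows "(\<lambda>a. qpoch_inf a q) holomorphic_on UNIV"
proof (rule holomorphic_uniform_sequence)
  show "open (UNIV :: complex set)" by simp
  show "(\<lambda>a. \<Prod>i<n. 1 - a * q ^ i) holomorphic_on UNIV" for n
    by (intro holomorphic_intros)
  fix x :: complex
  let ?K = "cball x 1"
  have "uniformly_convergent_on ?K (\<lambda>N a. \<Prod>i<N. 1 - a * q ^ i)"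
  proof (rule uniformly_convergent_on_prod')
    have "uniformly_convergent_on ?K (\<lambda>N a. \<Sum>i<N. norm (a * q ^ i))"
    proof (rule Weierstrass_m_test')
      fix i a assume "a \<in> ?K"
      then have "norm a \<le> norm x + 1"
        by (metis add.commute add_left_mono dist_norm mem_cball norm_minus_commute
            norm_triangle_sub order_trans)
      then show "norm (norm (a * q ^ i)) \<le> (norm x + 1) * norm q ^ i"
        by (simp add: norm_mult norm_power mult_right_mono)
    next
      show "summable (\<lambda>i. (norm x + 1) * norm q ^ i)"
        using q by (intro summable_mult summable_geometric) auto
    qed
    then show "uniformly_convergent_on ?K (\<lambda>N a. \<Sum>i<N. norm (1 - a * q ^ i - 1))"
      by simp
  qed (auto intro!: continuous_intros)
  moreover have "lim (\<lambda>N. \<Prod>i<N. 1 - a * q ^ i) = qpoch_inf a q" for a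
  proof -
    have "(\<lambda>N. \<Prod>i\<le>N. 1 - a * q ^ i) \<longlonglongrightarrow> qpoch_inf a q"
      unfolding qpoch_inf_def by (rule convergent_prod_LIMSEQ [OF convergent_prod_qpoch_inf [OF q]])
    then show ?thesis
      using LIMSEQ_lessThan_iff_atMost limI by blast
  qed
  ultimately have "uniform_limit ?K (\<lambda>N a. \<Prod>i<N. 1 - a * q ^ i) (\<lambda>a. qpoch_inf a q) sequentially"
    by (simp add: uniformly_convergent_uniform_limit_iff)
  then show "\<exists>d>0. cball x d \<subseteq> UNIV \<and>
      uniform_limit (cball x d) (\<lambda>N a. \<Prod>i<N. 1 - a * q ^ i) (\<lambda>a. qpoch_inf a q) sequentially"
    by (intro exI [of _ 1]) auto
qed

lemma holomorphic_on_qpoch_inf [holomorphic_intros]: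
  assumes "norm q < 1" "f holomorphic_on S"
  shows "(\<lambda>z. qpoch_inf (f z) q) holomorphic_on S"
  using holomorphic_on_compose_gen [OF assms(2) holomorphic_qpoch_inf [OF assms(1)]]
  by (simp add: o_def)

section \<open>Means over the unit circle\<close>

text \<open>The normalised contour integral of f(z) dz/z, parametrised over [0,1] so that z -> 1/z
  becomes t -> 1 - t and the radius of a circle moves into the argument of \<open>f\<close>.\<close>

definition circ_mean :: "(complex \<Rightarrow> complex) \<Rightarrow> complex" where
  "circ_mean f = integral {0..1} (\<lambda>t. f (exp (2 * of_real pi * \<i> * of_real t)))"

lemma contour_integral_circlepath_0:
  assumes "r \<noteq> 0"
  shows "contour_integral (circlepath 0 r) (\<lambda>z. f z / z)
    = 2 * of_real pi * \<i> * circ_mean (\<lambda>z. f (of_real r * z))"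
proof -
  have "contour_integral (circlepath 0 r) (\<lambda>z. f z / z)
     = integral {0..1} (\<lambda>t. 2 * of_real pi * \<i> * f (of_real r * exp (2 * of_real pi * \<i> * of_real t)))"
    unfolding contour_integral_integral vector_derivative_circlepath
    by (rule integral_cong) (use assms in \<open>simp add: circlepath\<close>)
  then show ?thesis
    by (simp add: circ_mean_def)
qed

lemma cher_form_circ_mean:
  "cher_form t1 t2 t3 t4 q f g = circ_mean (\<lambda>z. f z * g z * w_cher t1 t2 t3 t4 q z)"
  unfolding cher_form_def
  using contour_integral_circlepath_0 [of 1 "\<lambda>z. f z * g z * w_cher t1 t2 t3 t4 q z"] by simp

lemma circ_mean_cong:
  assumes "\<And>z. norm z = 1 \<Longrightarrow> f z = g z"
  shows "circ_mean f = circ_mean g"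
  unfolding circ_mean_def by (intro integral_cong assms) simp

lemma circ_mean_cmult: "circ_mean (\<lambda>z. c * f z) = c * circ_mean f"
  unfolding circ_mean_def by simp

lemma circ_mean_integrable:
  fixes f :: "complex \<Rightarrow> complex"
  assumes "continuous_on (sphere 0 1) f"
  shows "(\<lambda>t. f (exp (2 * of_real pi * \<i> * of_real t))) integrable_on {0..1::real}"
proof (rule integrable_continuous_real)
  show "continuous_on {0..1} (\<lambda>t::real. f (exp (2 * of_real pi * \<i> * of_real t)))"
    by (rule continuous_on_compose2 [OF assms]) (auto intro!: continuous_intros)
qed

lemma circ_mean_add:
  assumes "continuous_on (sphere 0 1) f" "continuous_on (sphere 0 1) g"
  shows "circ_mean (\<lambda>z. f z + g z) = circ_mean f + circ_mean g"
  unfolding circ_mean_def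
  by (intro integral_add circ_mean_integrable assms)

lemma circ_mean_inverse: "circ_mean (\<lambda>z. f (1 / z)) = circ_mean f"
proof -
  \<comment> \<open>This combines t -> -t with a shift by 1; on the circle it is z -> 1/z, because
    exp(2 pi i) = 1.\<close>
  have reflect: "integral {0..1} h = integral {0..1} (\<lambda>t. h (1 - t))" for h :: "real \<Rightarrow> complex"
    using integral_shift_Icc_real [of 0 1 "\<lambda>t. h (- t)" "-1"]
      Henstock_Kurzweil_Integration.integral_reflect_real [of 1 0 h]
    by (simp add: o_def)
  show ?thesis
    unfolding circ_mean_def
    by (subst (2) reflect) (simp add: exp_diff ring_distribs exp_two_pi_i')
qed

lemma circ_mean_symmetrise:
  assumes "continuous_on (sphere 0 1) f"
  shows "2 * circ_mean f = circ_mean (\<lambda>z. f z + f (1 / z))"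
proof -
  have "continuous_on (sphere 0 1) (\<lambda>z. f (1 / z))"
    by (intro continuous_on_compose2 [OF assms] continuous_intros) (auto simp: norm_divide)
  then show ?thesis
    using circ_mean_add [OF assms] circ_mean_inverse [of f] by simp
qed

text \<open>Cauchy's theorem: f(z)/z is holomorphic on an open set containing the annulus s <= |z|
  <= 1, in which the two circles are homotopic along radii.\<close>

lemma circ_mean_dilate:
  assumes "0 < s" "s < 1" "open S" "f holomorphic_on S" "\<And>z. s \<le> norm z \<Longrightarrow> norm z \<le> 1 \<Longrightarrow> z \<in> S"
  shows "circ_mean f = circ_mean (\<lambda>z. f (of_real s * z))"
proof -
  have "contour_integral (circlepath 0 1) (\<lambda>z. f z / z)
     = contour_integral (circlepath 0 s) (\<lambda>z. f z / z)"
  proof (rule Cauchy_theorem_homotopic_loops)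
    show "open (S - {0})" using assms(3) by blast
    show "(\<lambda>z. f z / z) holomorphic_on S - {0}"
      by (intro holomorphic_intros holomorphic_on_subset [OF assms(4)]) auto
    show "homotopic_loops (S - {0}) (circlepath 0 1) (circlepath 0 s)"
    proof (rule homotopic_loops_linear)
      fix t :: real
      let ?e = "exp (2 * of_real pi * \<i> * of_real t) :: complex"
      show "closed_segment (circlepath 0 1 t) (circlepath 0 s t) \<subseteq> S - {0}"
      proof
        fix z assume "z \<in> closed_segment (circlepath 0 1 t) (circlepath 0 s t)"
        then obtain u where u: "0 \<le> u" "u \<le> 1" "z = (1 - u) *\<^sub>R ?e + u *\<^sub>R (s *\<^sub>R ?e)"
          by (auto simp: closed_segment_def circlepath scaleR_conv_of_real)
        then have z: "z = (1 - u + u * s) *\<^sub>R ?e"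
          by (simp add: scaleR_add_left)
        have b: "s \<le> 1 - u + u * s" "1 - u + u * s \<le> 1"
          using u assms(1,2) mult_left_mono[of s 1 u] mult_nonneg_nonneg[of "1-u" "1-s"]
          by (auto simp: algebra_simps)
        have "norm ?e = 1" by (simp add: norm_exp_i_times)
        with b assms(1) have "norm z = 1 - u + u * s"
          unfolding z norm_scaleR by simp
        then show "z \<in> S - {0}"
          using b assms(1) assms(5)[of z] by auto
      qed
    qed auto
  qed auto
  then show ?thesis
    using contour_integral_circlepath_0 [of 1 f] contour_integral_circlepath_0 [of s f] assms(1)
    by simp
qed

section \<open>Askey--Wilson polynomials\<close>

lemma qpoch_0 [simp]: "qpoch a q 0 = 1"
  by (simp add: qpoch_def)

lemma qpoch_Suc: "qpoch a q (Suc k) = qpoch a q k * (1 - a * q ^ k)"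
  by (simp add: qpoch_def)

lemma qpoch_Suc_shift: "qpoch a q (Suc k) = (1 - a) * qpoch (q * a) q k"
  by (simp add: qpoch_def prod.lessThan_Suc_shift mult_ac del: prod.lessThan_Suc)

text \<open>The factor with index \<open>m\<close> is zero. This is what terminates the series
  \<open>phi43\<close>.\<close>

lemma qpoch_eq_0:
  assumes "q \<noteq> 0" "m < k"
  shows "qpoch (1 / q ^ m) q k = 0"
  unfolding qpoch_def by (rule prod_zero) (use assms in \<open>auto intro!: bexI [of _ m]\<close>)

lemma qpoch_nonzero: "norm q < 1 \<Longrightarrow> norm a < 1 \<Longrightarrow> qpoch a q k \<noteq> 0"
  unfolding qpoch_def using one_minus_mult_power_nonzero by simp

lemma norm_mult_less_1:
  fixes a b :: complex
  shows "norm a < 1 \<Longrightarrow> norm b < 1 \<Longrightarrow> norm (a * b) < 1"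
  by (metis mult.right_neutral mult_strict_mono' norm_ge_zero norm_mult)

text \<open>The part of the k-th term of the series that is free of z. The power q^(n-1) is written
  \<open>q ^ n / q\<close>, which avoids truncated subtraction at n = 0.\<close>

definition aw_coeff where
  "aw_coeff q t1 t2 t3 t4 n k =
    qpoch (1 / q ^ n) q k * qpoch (t1 * t2 * t3 * t4 * q ^ n / q) q k
    / (qpoch q q k * qpoch (t1 * t2) q k * qpoch (t1 * t3) q k * qpoch (t1 * t4) q k) * q ^ k"

definition aw_poly where
  "aw_poly q t1 t2 t3 t4 n z =
    (\<Sum>k\<le>n. aw_coeff q t1 t2 t3 t4 n k * (qpoch (t1 * z) q k * qpoch (t1 / z) q k))"

definition aw_A :: "complex \<Rightarrow> complex \<Rightarrow> complex \<Rightarrow> complex \<Rightarrow> complex" where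
  "aw_A t1 t2 t3 t4 = (1 - t1 * t2) * (1 - t1 * t3) * (1 - t1 * t4)"

lemma aw_poly_0 [simp]: "aw_poly q t1 t2 t3 t4 0 z = 1"
  by (simp add: aw_poly_def aw_coeff_def)

lemma aw_poly_inverse: "aw_poly q t1 t2 t3 t4 n (1 / z) = aw_poly q t1 t2 t3 t4 n z"
  by (simp add: aw_poly_def mult.commute)

lemma holomorphic_qpoch [holomorphic_intros]:
  "f holomorphic_on S \<Longrightarrow> (\<lambda>z. qpoch (f z) q k) holomorphic_on S"
  unfolding qpoch_def by (intro holomorphic_intros)

lemma holomorphic_aw_poly [holomorphic_intros]:
  assumes "f holomorphic_on S" "\<And>z. z \<in> S \<Longrightarrow> f z \<noteq> 0"
  shows "(\<lambda>z. aw_poly q t1 t2 t3 t4 n (f z)) holomorphic_on S"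
  unfolding aw_poly_def by (intro holomorphic_intros assms)

section \<open>Lowering and raising relations\<close>

text \<open>Splitting the first factor off the products in t/(sy) and ty/s and the last factor off
  the other two leaves the same k-fold products in both terms. Only a difference of two-factor
  products has to be computed.\<close>

lemma qpoch_lowering:
  assumes "s \<noteq> 0" "y \<noteq> 0" "q = s * s"
  shows "qpoch (t * (s * y)) q (Suc k) * qpoch (t / (s * y)) q (Suc k)
      - qpoch (t * (s / y)) q (Suc k) * qpoch (t / (s / y)) q (Suc k)
    = (y - 1 / y) * (t / s) * (1 - q ^ Suc k) * (qpoch (s * t * y) q k * qpoch (s * t / y) q k)"
proof -
  have e: "q * (t / (s * y)) = s * t / y" "q * (t / (s / y)) = s * t * y"
    "t * (s * y) = s * t * y" "t * (s / y) = s * t / y"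
    using assms by (auto simp: field_simps)
  define X where "X = q ^ k"
  have X: "(1 - s * t * y * X) * (1 - t / (s * y)) - (1 - s * t / y * X) * (1 - t / (s / y))
    = (y - 1 / y) * (t / s) * (1 - q * X)"
    using assms by (simp add: divide_simps) (simp add: algebra_simps)
  show ?thesis
    unfolding qpoch_Suc_shift [of "t / (s * y)"] qpoch_Suc_shift [of "t / (s / y)"] e
      qpoch_Suc [of "s * t * y"] qpoch_Suc [of "s * t / y"]
    using X unfolding X_def [symmetric] power_Suc by algebra
qed

text \<open>Used with u = t1 q^k for the k-th summand of the raising relation. The factor (1 - u
  z)(1 - u w) is the quotient of consecutive basis functions, so each summand becomes a combination
  of just two of them.\<close>

lemma raising_identity:
  fixes z w u b c d :: complex
  assumes "z * w = 1"
  shows "u * (z * (1 - z\<^sup>2) * ((1 - u * w) * (1 - b * w) * (1 - c * w) * (1 - d * w))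
      + w * (1 - w\<^sup>2) * ((1 - u * z) * (1 - b * z) * (1 - c * z) * (1 - d * z)))
    = (1 - z\<^sup>2) * (1 - w\<^sup>2) * ((1 - u * b) * (1 - u * c) * (1 - u * d)
        - (1 - u * b * c * d) * ((1 - u * z) * (1 - u * w)))"
  using assms by algebra

text \<open>The locale is closed under multiplying all four parameters by \<open>s\<close> (see
  \<open>shifted\<close>), which is what the induction for orthogonality runs on. The real number
  \<sigma> is the radius to which the contour is moved.\<close>

locale cher =
  fixes \<sigma> :: real and s q t1 t2 t3 t4 :: complex
  assumes \<sigma>: "0 < \<sigma>" "\<sigma> < 1"
    and s_def: "s = of_real \<sigma>" and q_def: "q = s * s"
    and t: "norm t1 < 1" "norm t2 < 1" "norm t3 < 1" "norm t4 < 1"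
begin

lemma s_nonzero: "s \<noteq> 0" and q_nonzero: "q \<noteq> 0" and norm_s_less_1: "norm s < 1"
  using \<sigma> by (auto simp: s_def q_def)

lemma norm_q_less_1: "norm q < 1"
  using norm_mult_less_1 [OF norm_s_less_1 norm_s_less_1] by (simp add: q_def)

lemma shifted: "cher \<sigma> s q (s * t1) (s * t2) (s * t3) (s * t4)"
  by unfold_locales (intro \<sigma> s_def q_def norm_mult_less_1 norm_s_less_1 t)+

lemma pair_nonzero:
  "1 - t1 * t2 \<noteq> 0" "1 - t1 * t3 \<noteq> 0" "1 - t1 * t4 \<noteq> 0"
  using one_minus_mult_power_nonzero [OF norm_q_less_1 norm_mult_less_1, of _ _ 0] t by auto

lemma A_nonzero: "aw_A t1 t2 t3 t4 \<noteq> 0"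
  using pair_nonzero by (simp add: aw_A_def)

lemma q_pair_nonzero:
  "1 - q * q ^ k \<noteq> 0"
  "1 - q * (t1 * t2) * q ^ k \<noteq> 0" "1 - q * (t1 * t3) * q ^ k \<noteq> 0" "1 - q * (t1 * t4) * q ^ k \<noteq> 0"
  by (intro one_minus_mult_power_nonzero norm_mult_less_1 t norm_q_less_1)+

lemma qpoch_pair_nonzero:
  "qpoch q q k \<noteq> 0"
  "qpoch (q * (t1 * t2)) q k \<noteq> 0" "qpoch (q * (t1 * t3)) q k \<noteq> 0" "qpoch (q * (t1 * t4)) q k \<noteq> 0"
  by (intro qpoch_nonzero norm_mult_less_1 t norm_q_less_1)+

lemma shifted_params:
  "s * t1 * (s * t2) = q * (t1 * t2)" "s * t1 * (s * t3) = q * (t1 * t3)"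
  "s * t1 * (s * t4) = q * (t1 * t4)"
  "q * (t1 * t2) * (s * t3) * (s * t4) * q ^ n / q = q * (t1 * t2 * t3 * t4 * q ^ Suc n / q)"
  using s_nonzero by (simp_all add: q_def)

text \<open>Splitting the first factor off a q-factorial multiplies its parameter by q, and the
  resulting parameters are those belonging to \<open>s * t1\<close>, ..., \<open>s * t4\<close> and
  degree \<open>n\<close>. Only (q;q) loses its last factor, \<open>1 - q ^ Suc k\<close>.\<close>

lemma aw_coeff_lowering:
  "aw_coeff q t1 t2 t3 t4 (Suc n) (Suc k) * (1 - q ^ Suc k)
    = (1 - 1 / q ^ Suc n) * (1 - t1 * t2 * t3 * t4 * q ^ Suc n / q) * q / aw_A t1 t2 t3 t4
      * aw_coeff q (s * t1) (s * t2) (s * t3) (s * t4) n k"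
proof -
  have e: "q * (1 / q ^ Suc n) = 1 / q ^ n"
    using q_nonzero by simp
  have "1 - q ^ Suc k \<noteq> 0" using q_pair_nonzero(1)[of k] by simp
  then show ?thesis
    using qpoch_pair_nonzero [of k] pair_nonzero
    unfolding aw_coeff_def shifted_params qpoch_Suc_shift [of "1 / q ^ Suc n"] aw_A_def
      qpoch_Suc_shift [of "t1 * t2 * t3 * t4 * q ^ Suc n / q"] e
      qpoch_Suc_shift [of "t1 * t2"] qpoch_Suc_shift [of "t1 * t3"] qpoch_Suc_shift [of "t1 * t4"]
      qpoch_Suc [of q]
    by (simp add: divide_simps)
qed

lemma aw_poly_lowering:
  assumes "y \<noteq> 0"
  shows "aw_poly q t1 t2 t3 t4 (Suc n) (s * y) - aw_poly q t1 t2 t3 t4 (Suc n) (s / y)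
    = (y - 1 / y) * (t1 * s * (1 - 1 / q ^ Suc n) * (1 - t1 * t2 * t3 * t4 * q ^ Suc n / q)
        / aw_A t1 t2 t3 t4) * aw_poly q (s * t1) (s * t2) (s * t3) (s * t4) n y"
proof -
  \<comment> \<open>The summand k = 0 does not depend on z and cancels, so the index can be shifted
    down by one.\<close>
  have "aw_poly q t1 t2 t3 t4 (Suc n) (s * y) - aw_poly q t1 t2 t3 t4 (Suc n) (s / y)
    = (\<Sum>k\<le>n. aw_coeff q t1 t2 t3 t4 (Suc n) (Suc k) *
        (qpoch (t1 * (s * y)) q (Suc k) * qpoch (t1 / (s * y)) q (Suc k)
          - qpoch (t1 * (s / y)) q (Suc k) * qpoch (t1 / (s / y)) q (Suc k)))"
    unfolding aw_poly_def sum.atMost_Suc_shift right_diff_distrib sum_subtractf by simp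
  also have "\<dots> = (\<Sum>k\<le>n. (y - 1 / y) * (t1 / s) *
      (aw_coeff q t1 t2 t3 t4 (Suc n) (Suc k) * (1 - q ^ Suc k))
      * (qpoch (s * t1 * y) q k * qpoch (s * t1 / y) q k))"
    unfolding qpoch_lowering [OF s_nonzero assms q_def] by (simp add: mult_ac)
  also have "\<dots> = (\<Sum>k\<le>n. ((y - 1 / y) * (t1 * s * (1 - 1 / q ^ Suc n)
      * (1 - t1 * t2 * t3 * t4 * q ^ Suc n / q) / aw_A t1 t2 t3 t4))
      * (aw_coeff q (s * t1) (s * t2) (s * t3) (s * t4) n k
          * (qpoch (s * t1 * y) q k * qpoch (s * t1 / y) q k)))"
    unfolding aw_coeff_lowering
    by (rule sum.cong [OF refl]) (use s_nonzero q_def in \<open>simp add: mult_ac\<close>)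
  finally show ?thesis
    unfolding aw_poly_def sum_distrib_left [symmetric] .
qed

text \<open>Comparison of the coefficients of the basis function with index k + 1 in the raising
  relation. After the common factor \<open>K\<close> is removed, it is a rational identity in X =
  q^k, Y = q^n and T = t1 t2 t3 t4.\<close>

lemma aw_coeff_raising:
  fixes n
  defines "c \<equiv> aw_coeff q (s * t1) (s * t2) (s * t3) (s * t4) n"
  shows "c (Suc k) / q ^ Suc k
      * ((1 - t1 * t2 * q ^ Suc k) * (1 - t1 * t3 * q ^ Suc k) * (1 - t1 * t4 * q ^ Suc k))
    - c k / q ^ k * (1 - t1 * t2 * t3 * t4 * q ^ k)
    = aw_A t1 t2 t3 t4 * aw_coeff q t1 t2 t3 t4 (Suc n) (Suc k)"
proof -
  define X Y T where "X = q ^ k" and "Y = q ^ n" and "T = t1 * t2 * t3 * t4"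
  have XY: "X \<noteq> 0" "Y \<noteq> 0" using q_nonzero by (auto simp: X_def Y_def)
  define K where "K = qpoch (1 / q ^ n) q k * qpoch (q * (T * q ^ Suc n / q)) q k
    / (qpoch q q k * qpoch (q * (t1 * t2)) q k * qpoch (q * (t1 * t3)) q k
        * qpoch (q * (t1 * t4)) q k)"
  have e: "q * (1 / q ^ Suc n) = 1 / q ^ n"
    using q_nonzero by simp
  have nz: "1 - q * X \<noteq> 0" "1 - q * (t1 * t2) * X \<noteq> 0" "1 - q * (t1 * t3) * X \<noteq> 0"
    "1 - q * (t1 * t4) * X \<noteq> 0"
    using q_pair_nonzero [of k] by (auto simp: X_def)
  have ck: "c k / q ^ k = K"
    unfolding c_def aw_coeff_def shifted_params K_def T_def using q_nonzero by simp
  have "c (Suc k) / q ^ Suc k = K * (1 - X / Y) * (1 - q * T * Y * X)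
    / ((1 - q * X) * (1 - q * (t1 * t2) * X) * (1 - q * (t1 * t3) * X) * (1 - q * (t1 * t4) * X))"
    unfolding c_def aw_coeff_def shifted_params K_def T_def X_def Y_def qpoch_Suc
    using q_nonzero by (simp add: mult_ac)
  then have cSk: "c (Suc k) / q ^ Suc k
      * ((1 - t1 * t2 * q ^ Suc k) * (1 - t1 * t3 * q ^ Suc k) * (1 - t1 * t4 * q ^ Suc k))
     = K * (1 - X / Y) * (1 - q * T * Y * X) / (1 - q * X)"
    using nz by (simp add: X_def mult_ac)
  have d: "aw_A t1 t2 t3 t4 * aw_coeff q t1 t2 t3 t4 (Suc n) (Suc k)
    = K * (1 - 1 / (q * Y)) * (1 - T * Y) * (q * X) / (1 - q * X)"
    unfolding aw_coeff_def qpoch_Suc_shift [of "1 / q ^ Suc n"] aw_A_def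
      qpoch_Suc_shift [of "t1 * t2 * t3 * t4 * q ^ Suc n / q"] e
      qpoch_Suc_shift [of "t1 * t2"] qpoch_Suc_shift [of "t1 * t3"] qpoch_Suc_shift [of "t1 * t4"]
      qpoch_Suc [of q] K_def X_def Y_def T_def
    using pair_nonzero q_nonzero by (simp add: mult_ac)
  have "(1 - X / Y) * (1 - q * T * Y * X) / (1 - q * X) - (1 - T * X)
    = (1 - 1 / (q * Y)) * (1 - T * Y) * (q * X) / (1 - q * X)"
    using nz(1) XY q_nonzero by (simp add: divide_simps) algebra
  moreover have "K * x * y / v - K * p = K * a * b * c / v" if "x * y / v - p = a * b * c / v"
    for x y v p a b c
    by (metis that mult.assoc right_diff_distrib times_divide_eq_right)
  ultimately show ?thesis
    unfolding cSk d unfolding ck T_def X_def by blast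
qed

text \<open>By \<open>raising_identity\<close>, the k-th summand is a combination of
  \<open>\<phi> k\<close> and \<open>\<phi> (Suc k)\<close>. Collecting the terms with the same
  \<phi> gives the coefficients of degree n + 1 through \<open>aw_coeff_raising\<close>.\<close>

lemma aw_poly_raising:
  fixes n
  assumes z: "z \<noteq> 0" and t1: "t1 \<noteq> 0"
  defines "P \<equiv> aw_poly q (s * t1) (s * t2) (s * t3) (s * t4) n"
  shows "z * (1 - z\<^sup>2) * ((1 - t1 / z) * (1 - t2 / z) * (1 - t3 / z) * (1 - t4 / z)) * P (z / s)
      + 1 / z * (1 - (1 / z)\<^sup>2) * ((1 - t1 * z) * (1 - t2 * z) * (1 - t3 * z) * (1 - t4 * z))
        * P (1 / z / s)
    = (1 - z\<^sup>2) * (1 - (1 / z)\<^sup>2) * (aw_A t1 t2 t3 t4 / t1) * aw_poly q t1 t2 t3 t4 (Suc n) z"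
    (is "?L = _")
proof -
  define w where "w = 1 / z"
  have zw: "z * w = 1" using z by (simp add: w_def)
  define c where "c = aw_coeff q (s * t1) (s * t2) (s * t3) (s * t4) n"
  define \<phi> where "\<phi> k = qpoch (t1 * z) q k * qpoch (t1 * w) q k" for k
  define E where "E k = (1 - t1 * t2 * q ^ k) * (1 - t1 * t3 * q ^ k) * (1 - t1 * t4 * q ^ k)" for k
  define F where "F k = 1 - t1 * t2 * t3 * t4 * q ^ k" for k
  define \<omega> where "\<omega> = (1 - z\<^sup>2) * (1 - w\<^sup>2)"
  have Pz: "P (z / s) = (\<Sum>k\<le>n. c k * (qpoch (t1 * z) q k * qpoch (q * (t1 * w)) q k))"
    unfolding P_def aw_poly_def c_def using s_nonzero by (simp add: q_def w_def mult_ac)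
  have Pw: "P (w / s) = (\<Sum>k\<le>n. c k * (qpoch (t1 * w) q k * qpoch (q * (t1 * z)) q k))"
    unfolding P_def aw_poly_def c_def using s_nonzero by (simp add: q_def w_def mult_ac)
  have term_k: "z * (1 - z\<^sup>2) * ((1 - t1 * w) * (1 - t2 * w) * (1 - t3 * w) * (1 - t4 * w))
        * (qpoch (t1 * z) q k * qpoch (q * (t1 * w)) q k)
      + w * (1 - w\<^sup>2) * ((1 - t1 * z) * (1 - t2 * z) * (1 - t3 * z) * (1 - t4 * z))
        * (qpoch (t1 * w) q k * qpoch (q * (t1 * z)) q k)
      = \<omega> / t1 * (E k / q ^ k * \<phi> k - F k / q ^ k * \<phi> (Suc k))" (is "?l = ?r") for k
  proof -
    \<comment> \<open>With x = t1 w this trades the factor 1 - t1 w for 1 - u w, where u = t1 q^k,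
      and leaves the unshifted product in \<open>\<phi> k\<close>; likewise with z in place of
      w.\<close>
    have shift: "(1 - x) * qpoch (q * x) q k = qpoch x q k * (1 - x * q ^ k)" for x
      using qpoch_Suc_shift [of x] qpoch_Suc [of x] by simp
    define u where "u = t1 * q ^ k"
    have u0: "u \<noteq> 0" using t1 q_nonzero by (simp add: u_def)
    have "?l = (z * (1 - z\<^sup>2) * (1 - t2 * w) * (1 - t3 * w) * (1 - t4 * w) * qpoch (t1 * z) q k)
          * ((1 - t1 * w) * qpoch (q * (t1 * w)) q k)
      + (w * (1 - w\<^sup>2) * (1 - t2 * z) * (1 - t3 * z) * (1 - t4 * z) * qpoch (t1 * w) q k)
          * ((1 - t1 * z) * qpoch (q * (t1 * z)) q k)"
      by (simp add: mult_ac)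
    also have "\<dots> = \<phi> k
        * (z * (1 - z\<^sup>2) * ((1 - u * w) * (1 - t2 * w) * (1 - t3 * w) * (1 - t4 * w))
      + w * (1 - w\<^sup>2) * ((1 - u * z) * (1 - t2 * z) * (1 - t3 * z) * (1 - t4 * z)))"
      unfolding shift \<phi>_def u_def by (simp add: algebra_simps)
    finally have "u * ?l = \<phi> k * (\<omega> * ((1 - u * t2) * (1 - u * t3) * (1 - u * t4)
        - (1 - u * t2 * t3 * t4) * ((1 - u * z) * (1 - u * w))))"
      unfolding \<omega>_def by (simp only: mult.left_commute [of u] raising_identity [OF zw])
    also have "\<dots> = \<omega> * (E k * \<phi> k - F k * \<phi> (Suc k))"
      by (simp add: E_def F_def \<phi>_def qpoch_Suc u_def algebra_simps)
    also have "\<dots> = u * ?r"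
      using t1 q_nonzero by (simp add: u_def field_simps)
    finally show ?thesis by (rule mult_left_cancel [OF u0, THEN iffD1])
  qed
  have "?L = z * (1 - z\<^sup>2) * ((1 - t1 * w) * (1 - t2 * w) * (1 - t3 * w) * (1 - t4 * w)) * P (z / s)
      + w * (1 - w\<^sup>2) * ((1 - t1 * z) * (1 - t2 * z) * (1 - t3 * z) * (1 - t4 * z)) * P (w / s)"
    by (simp add: w_def)
  also have "\<dots> = (\<Sum>k\<le>n. c k * (\<omega> / t1 * (E k / q ^ k * \<phi> k - F k / q ^ k * \<phi> (Suc k))))"
    unfolding term_k [symmetric] Pz Pw sum_distrib_left sum.distrib [symmetric]
    by (intro sum.cong refl) (simp only: distrib_left mult.left_commute [of "c _"])
  also have "\<dots> = \<omega> / t1 * ((\<Sum>k\<le>n. c k / q ^ k * E k * \<phi> k) - (\<Sum>k\<le>n. c k / q ^ k * F k * \<phi> (Suc k)))"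
    unfolding sum_subtractf [symmetric] sum_distrib_left
    by (intro sum.cong refl) (simp add: algebra_simps)
  \<comment> \<open>The added term vanishes, since \<open>c (Suc n)\<close> contains the zero
    factorial of q^(-n) of length n + 1.\<close>
  also have "(\<Sum>k\<le>n. c k / q ^ k * E k * \<phi> k) = (\<Sum>k\<le>Suc n. c k / q ^ k * E k * \<phi> k)"
    using qpoch_eq_0 [OF q_nonzero, of n "Suc n"] by (simp add: c_def aw_coeff_def)
  also have "\<dots> = c 0 * E 0 * \<phi> 0 + (\<Sum>k\<le>n. c (Suc k) / q ^ Suc k * E (Suc k) * \<phi> (Suc k))"
    unfolding sum.atMost_Suc_shift by simp
  also have "\<dots> - (\<Sum>k\<le>n. c k / q ^ k * F k * \<phi> (Suc k))
     = c 0 * E 0 * \<phi> 0 + (\<Sum>k\<le>n. (c (Suc k) / q ^ Suc k * E (Suc k) - c k / q ^ k * F k) * \<phi> (Suc k))"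
    by (simp add: sum_subtractf left_diff_distrib)
  \<comment> \<open>At k = 0 both coefficients are 1, and \<open>E 0\<close> is
    \<open>aw_A t1 t2 t3 t4\<close>.\<close>
  also have "\<dots> = aw_A t1 t2 t3 t4 * aw_coeff q t1 t2 t3 t4 (Suc n) 0 * \<phi> 0
      + (\<Sum>k\<le>n. aw_A t1 t2 t3 t4 * aw_coeff q t1 t2 t3 t4 (Suc n) (Suc k) * \<phi> (Suc k))"
    unfolding c_def E_def F_def aw_coeff_raising by (simp add: aw_coeff_def aw_A_def)
  also have "\<dots> = aw_A t1 t2 t3 t4 * aw_poly q t1 t2 t3 t4 (Suc n) z"
    unfolding aw_poly_def sum.atMost_Suc_shift
    by (simp add: \<phi>_def w_def sum_distrib_left algebra_simps)
  finally show ?thesis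
    unfolding \<omega>_def w_def by simp
qed

end

section \<open>The weights\<close>

text \<open>The Askey--Wilson weight without its factor (1 - z^2)(1 - 1/z^2), which
  \<open>aw_form\<close> puts back. Both this weight and the nonsymmetric one are then elementary
  factors times the same function, invariant under inversion.\<close>

definition aw_U :: "complex \<Rightarrow> complex \<Rightarrow> complex \<Rightarrow> complex \<Rightarrow> complex \<Rightarrow> complex \<Rightarrow> complex" where
  "aw_U q t1 t2 t3 t4 z =
    qpoch_inf q q * qpoch_inf (q * z\<^sup>2) q * qpoch_inf (q * (1 / z)\<^sup>2) q
    / (qpoch_inf (t1 * z) q * qpoch_inf (t2 * z) q * qpoch_inf (t3 * z) q * qpoch_inf (t4 * z) q
       * (qpoch_inf (t1 / z) q * qpoch_inf (t2 / z) q * qpoch_inf (t3 / z) q * qpoch_inf (t4 / z) q))"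

definition aw_form where
  "aw_form q t1 t2 t3 t4 f g =
    circ_mean (\<lambda>z. f z * g z * ((1 - z\<^sup>2) * (1 - (1 / z)\<^sup>2)) * aw_U q t1 t2 t3 t4 z)"

definition aw_H where
  "aw_H q t1 t2 t3 t4 m n = aw_form q t1 t2 t3 t4 (aw_poly q t1 t2 t3 t4 m) (aw_poly q t1 t2 t3 t4 n)"

definition cher_weight :: "complex \<Rightarrow> complex \<Rightarrow> complex \<Rightarrow> complex \<Rightarrow> complex \<Rightarrow> complex \<Rightarrow> complex" where
  "cher_weight q t1 t2 t3 t4 z =
    qpoch_inf q q * qpoch_inf (z\<^sup>2) q * qpoch_inf (q * (1 / z)\<^sup>2) q
    / (qpoch_inf (t1 * z) q * qpoch_inf (t2 * z) q * qpoch_inf (t3 * z) q * qpoch_inf (t4 * z) q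
       * (qpoch_inf (q * t1 / z) q * qpoch_inf (q * t2 / z) q * qpoch_inf (t3 / z) q * qpoch_inf (t4 / z) q))"

definition cher_pair where
  "cher_pair q t1 t2 t3 t4 f g = circ_mean (\<lambda>z. f z * g z * cher_weight q t1 t2 t3 t4 z)"

text \<open>The index is shifted: \<open>cher_S s q t1 t2 t3 t4 n\<close> is the paper's \<open>S\<^sub>n\<^sub>+\<^sub>1\<close>, and \<open>s\<close> is a square root of \<open>q\<close>.\<close>
definition cher_S where
  "cher_S s q t1 t2 t3 t4 n z =
    z * ((1 - t3 / z) * (1 - t4 / z)) * aw_poly q (s * t1) (s * t2) (s * t3) (s * t4) n (z / s)"

lemma aw_U_inverse: "aw_U q t1 t2 t3 t4 (1 / z) = aw_U q t1 t2 t3 t4 z"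
  by (simp add: aw_U_def mult_ac)

lemma aw_form_commute: "aw_form q t1 t2 t3 t4 f g = aw_form q t1 t2 t3 t4 g f"
  by (simp add: aw_form_def mult.commute [of "f _"])

lemma cher_pair_commute: "cher_pair q t1 t2 t3 t4 f g = cher_pair q t1 t2 t3 t4 g f"
  by (simp add: cher_pair_def mult.commute [of "f _"])

lemma aw_H_commute: "aw_H q t1 t2 t3 t4 m n = aw_H q t1 t2 t3 t4 n m"
  unfolding aw_H_def by (rule aw_form_commute)

lemma holomorphic_aw_U:
  assumes "norm q < 1" "norm t1 < 1" "norm t2 < 1" "norm t3 < 1" "norm t4 < 1"
  shows "aw_U q t1 t2 t3 t4 holomorphic_on sphere 0 1"
proof -
  have nz: "qpoch_inf (a * z) q \<noteq> 0" "qpoch_inf (a / z) q \<noteq> 0"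
    if "norm a < 1" "z \<in> sphere 0 1" for a z
    by (rule qpoch_inf_nonzero; use assms(1) that in \<open>simp add: norm_mult norm_divide\<close>)+
  show ?thesis
    unfolding aw_U_def [abs_def]
    by (intro holomorphic_intros assms(1) no_zero_divisors nz assms(2-5)) auto
qed

context cher
begin

abbreviation "U \<equiv> aw_U q t1 t2 t3 t4"
abbreviation "R \<equiv> aw_poly q t1 t2 t3 t4"
abbreviation "S \<equiv> cher_S s q t1 t2 t3 t4"
abbreviation "A \<equiv> aw_A t1 t2 t3 t4"
abbreviation "pair \<equiv> cher_pair q t1 t2 t3 t4"
abbreviation "R' \<equiv> aw_poly q (s * t1) (s * t2) (s * t3) (s * t4)"
abbreviation "U' \<equiv> aw_U q (s * t1) (s * t2) (s * t3) (s * t4)"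
abbreviation "H' \<equiv> aw_H q (s * t1) (s * t2) (s * t3) (s * t4)"

lemma holomorphic_U [holomorphic_intros]: "U holomorphic_on sphere 0 1"
  by (rule holomorphic_aw_U [OF norm_q_less_1 t])

lemma continuous_U [continuous_intros]: "continuous_on (sphere 0 1) U"
  by (rule holomorphic_on_imp_continuous_on [OF holomorphic_U])

lemma holomorphic_S: "S n holomorphic_on - {0}"
  unfolding cher_S_def [abs_def] by (intro holomorphic_intros) (use s_nonzero in auto)

lemma holomorphic_R: "R n holomorphic_on - {0}"
  by (rule holomorphic_aw_poly [where f = "\<lambda>z. z", unfolded]) (auto intro: holomorphic_intros)

lemma continuous_R [continuous_intros]: "continuous_on (sphere 0 1) (R n)"
  and continuous_S [continuous_intros]: "continuous_on (sphere 0 1) (S n)"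
  by (rule holomorphic_on_imp_continuous_on, rule holomorphic_on_subset [where s = "- {0}"],
      auto intro: holomorphic_R holomorphic_S)+

text \<open>Three products lose or gain their first factor: the one in z^2 supplies 1 - z^2, while
  those in q t1/z and q t2/z become the ones in t1/z and t2/z. On the unit circle the factors
  divided out are nonzero.\<close>

lemma cher_weight_eq:
  assumes "norm z = 1"
  shows "cher_weight q t1 t2 t3 t4 z = (1 - z\<^sup>2) * ((1 - t1 / z) * (1 - t2 / z)) * U z"
proof -
  have "1 - t1 / z \<noteq> 0" "1 - t2 / z \<noteq> 0"
    using one_minus_mult_power_nonzero [OF norm_q_less_1, of "t1 / z" 0]
      one_minus_mult_power_nonzero [OF norm_q_less_1, of "t2 / z" 0] t assms
    by (auto simp: norm_divide)
  moreover define a b where "a = 1 - t1 / z" and "b = 1 - t2 / z"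
  ultimately have "a \<noteq> 0" "b \<noteq> 0" by simp_all
  then show ?thesis
    unfolding cher_weight_def aw_U_def qpoch_inf_step [OF norm_q_less_1, of "z\<^sup>2"]
      qpoch_inf_step [OF norm_q_less_1, of "t1 / z"] qpoch_inf_step [OF norm_q_less_1, of "t2 / z"]
      a_def [symmetric] b_def [symmetric] times_divide_eq_right
    by (simp add: mult_ac)
qed

lemma continuous_cher_weight: "continuous_on (sphere 0 1) (cher_weight q t1 t2 t3 t4)"
proof -
  have "continuous_on (sphere 0 1) (\<lambda>z. (1 - z\<^sup>2) * ((1 - t1 / z) * (1 - t2 / z)) * U z)"
    by (intro continuous_intros) auto
  then show ?thesis
    by (rule continuous_on_eq) (simp add: cher_weight_eq)
qed

lemma pair_bilinear:
  assumes "continuous_on (sphere 0 1) f" "continuous_on (sphere 0 1) g"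
    "continuous_on (sphere 0 1) h" "continuous_on (sphere 0 1) k"
  shows "pair (\<lambda>z. a * f z + b * g z) (\<lambda>z. c * h z + d * k z)
    = a * c * pair f h + a * d * pair f k + b * c * pair g h + b * d * pair g k"
proof -
  let ?w = "cher_weight q t1 t2 t3 t4"
  note [continuous_intros] = assms continuous_cher_weight
  have "pair (\<lambda>z. a * f z + b * g z) (\<lambda>z. c * h z + d * k z)
    = circ_mean (\<lambda>z. a * c * (f z * h z * ?w z) + a * d * (f z * k z * ?w z)
        + b * c * (g z * h z * ?w z) + b * d * (g z * k z * ?w z))"
    unfolding cher_pair_def by (simp add: algebra_simps)
  then show ?thesis
    unfolding cher_pair_def by (simp add: circ_mean_add circ_mean_cmult continuous_intros)
qed

section \<open>Pairings by symmetrisation under z -> 1/z\<close>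

text \<open>Only the factor (1 - z^2)(1 - t1/z)(1 - t2/z) changes under inversion, and the sum of
  its two versions is (1 - t1 t2)(1 - z^2)(1 - 1/z^2).\<close>

lemma pair_symmetric:
  assumes "\<And>z. f (1 / z) = f z" "\<And>z. g (1 / z) = g z"
    and cont: "continuous_on (sphere 0 1) f" "continuous_on (sphere 0 1) g"
  shows "2 * pair f g = (1 - t1 * t2) * aw_form q t1 t2 t3 t4 f g"
proof -
  let ?h = "\<lambda>z. f z * g z * ((1 - z\<^sup>2) * ((1 - t1 / z) * (1 - t2 / z)) * U z)"
  have "2 * pair f g = 2 * circ_mean ?h"
    unfolding cher_pair_def by (simp add: cher_weight_eq cong: circ_mean_cong)
  also have "\<dots> = circ_mean (\<lambda>z. ?h z + ?h (1 / z))"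
    by (intro circ_mean_symmetrise continuous_intros cont) auto
  also have "\<dots> = circ_mean (\<lambda>z. (1 - t1 * t2)
      * (f z * g z * ((1 - z\<^sup>2) * (1 - (1 / z)\<^sup>2)) * U z))"
  proof (rule circ_mean_cong)
    fix z :: complex assume "norm z = 1"
    define w where "w = 1 / z"
    have zw: "z * w = 1" using \<open>norm z = 1\<close> by (auto simp: w_def)
    have "(1 - z\<^sup>2) * ((1 - t1 * w) * (1 - t2 * w)) + (1 - w\<^sup>2) * ((1 - t1 * z) * (1 - t2 * z))
       = (1 - t1 * t2) * ((1 - z\<^sup>2) * (1 - w\<^sup>2))"
      using zw by algebra
    then have "f z * g z * U z * ((1 - z\<^sup>2) * ((1 - t1 * w) * (1 - t2 * w))
        + (1 - w\<^sup>2) * ((1 - t1 * z) * (1 - t2 * z)))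
       = f z * g z * U z * ((1 - t1 * t2) * ((1 - z\<^sup>2) * (1 - w\<^sup>2)))"
      by simp
    then show "?h z + ?h (1 / z) = (1 - t1 * t2)
      * (f z * g z * ((1 - z\<^sup>2) * (1 - (1 / z)\<^sup>2)) * U z)"
      unfolding assms aw_U_inverse by (simp add: w_def algebra_simps)
  qed
  finally show ?thesis
    by (simp only: circ_mean_cmult aw_form_def)
qed

text \<open>The factors 1 - t3/z and 1 - t4/z of \<open>S\<close> complete those of the weight to a
  product over all four parameters, so the symmetrised integrand is the left side of
  \<open>aw_poly_raising\<close>.\<close>

lemma pair_symmetric_S:
  assumes "\<And>z. f (1 / z) = f z" and cont: "continuous_on (sphere 0 1) f" and t1: "t1 \<noteq> 0"
  shows "2 * t1 * pair f (S n) = A * aw_form q t1 t2 t3 t4 f (R (Suc n))"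
proof -
  let ?h = "\<lambda>z. f z * S n z * ((1 - z\<^sup>2) * ((1 - t1 / z) * (1 - t2 / z)) * U z)"
  have "2 * pair f (S n) = 2 * circ_mean ?h"
    unfolding cher_pair_def by (simp add: cher_weight_eq cong: circ_mean_cong)
  also have "\<dots> = circ_mean (\<lambda>z. ?h z + ?h (1 / z))"
    by (intro circ_mean_symmetrise continuous_intros cont) auto
  also have "\<dots> = circ_mean (\<lambda>z. A / t1
      * (f z * R (Suc n) z * ((1 - z\<^sup>2) * (1 - (1 / z)\<^sup>2)) * U z))"
  proof (rule circ_mean_cong)
    fix z :: complex assume "norm z = 1"
    then have z: "z \<noteq> 0" by auto
    have "?h z + ?h (1 / z) = f z * U z *
     (z * (1 - z\<^sup>2) * ((1 - t1 / z) * (1 - t2 / z) * (1 - t3 / z) * (1 - t4 / z)) * R' n (z / s)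
      + 1 / z * (1 - (1 / z)\<^sup>2) * ((1 - t1 * z) * (1 - t2 * z) * (1 - t3 * z) * (1 - t4 * z))
        * R' n (1 / z / s))"
    proof -
      have "a / (1 / z) = a * z" for a by simp
      then show ?thesis
        unfolding assms aw_U_inverse cher_S_def by (simp only: distrib_left mult_ac)
    qed
    also have "\<dots> = A / t1 * (f z * R (Suc n) z * ((1 - z\<^sup>2) * (1 - (1 / z)\<^sup>2)) * U z)"
      unfolding aw_poly_raising [OF z t1] by (simp only: mult_ac)
    finally show "?h z + ?h (1 / z) = A / t1 * (f z * R (Suc n) z * ((1 - z\<^sup>2) * (1 - (1 / z)\<^sup>2)) * U z)" .
  qed
  also have "\<dots> = A / t1 * aw_form q t1 t2 t3 t4 f (R (Suc n))"
    by (simp only: circ_mean_cmult aw_form_def)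
  finally show ?thesis
    using t1 by (simp add: field_simps)
qed

section \<open>Pairings by moving the contour to |z| = q^(1/2)\<close>

text \<open>The zeros of \<open>S\<close> at t3 and t4 cancel poles of the weight, and the remaining
  poles inside the unit circle have modulus below |q|. The contour can therefore move to |z| =
  \<sigma>, where z = s y turns the weight into that of the shifted parameters.\<close>

lemma pair_S_dilate:
  assumes hol: "g holomorphic_on - {0}"
  shows "2 * pair g (S n)
    = s * circ_mean (\<lambda>y. (g (s * y) - g (s / y)) * (y - 1 / y) * R' n y * U' y)"
proof -
  interpret sh: cher \<sigma> s q "s * t1" "s * t2" "s * t3" "s * t4" by (rule shifted)
  define G where "G z = qpoch_inf q q * qpoch_inf (z\<^sup>2) q * qpoch_inf (q * (1 / z)\<^sup>2) q
    / (qpoch_inf (t1 * z) q * qpoch_inf (t2 * z) q * qpoch_inf (t3 * z) q * qpoch_inf (t4 * z) q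
       * (qpoch_inf (q * t1 / z) q * qpoch_inf (q * t2 / z) q * qpoch_inf (q * t3 / z) q
          * qpoch_inf (q * t4 / z) q))" for z
  define F where "F z = g z * (z * R' n (z / s)) * G z" for z
  \<comment> \<open>An open neighbourhood of the annulus on which no denominator of \<open>G\<close>
    vanishes: there |q t_j / z| < 1 and |t_j z| < 1.\<close>
  define D where "D = {z. norm q < norm z \<and> norm (t1 * z) < 1 \<and> norm (t2 * z) < 1
    \<and> norm (t3 * z) < 1 \<and> norm (t4 * z) < 1}"
  have nz: "1 - a / z \<noteq> 0" if "norm z = 1" "norm a < 1" for a z :: complex
    using one_minus_mult_power_nonzero [OF norm_q_less_1, of "a / z" 0] that by (auto simp: norm_divide)
  have "pair g (S n) = circ_mean F"
    unfolding cher_pair_def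
  proof (rule circ_mean_cong)
    fix z :: complex assume "norm z = 1"
    note nz = nz [OF this]
    define a b where "a = 1 - t3 / z" and "b = 1 - t4 / z"
    have ab: "a \<noteq> 0" "b \<noteq> 0" using nz t by (auto simp: a_def b_def)
    show "g z * S n z * cher_weight q t1 t2 t3 t4 z = F z"
      unfolding cher_weight_def F_def G_def cher_S_def
        qpoch_inf_step [OF norm_q_less_1, of "t3 / z"] qpoch_inf_step [OF norm_q_less_1, of "t4 / z"]
        a_def [symmetric] b_def [symmetric] times_divide_eq_right
      using ab by (simp add: mult_ac)
  qed
  also have "\<dots> = circ_mean (\<lambda>y. F (of_real \<sigma> * y))"
  proof (rule circ_mean_dilate [OF \<sigma>])
    show "open D"
      unfolding D_def by (intro open_Collect_conj open_Collect_less continuous_intros)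
    have D: "z \<noteq> 0" if "z \<in> D" for z
      using that by (auto simp: D_def)
    have D': "norm (q * a / z) < 1" if "z \<in> D" "norm a < 1" for a z :: complex
    proof -
      have "norm q * norm a \<le> norm q" using that by (simp add: mult_left_le)
      also have "\<dots> < norm z" using that by (simp add: D_def)
      finally show ?thesis using D [OF that(1)] by (simp add: norm_mult norm_divide)
    qed
    have nz1: "qpoch_inf (t1 * z) q \<noteq> 0" "qpoch_inf (t2 * z) q \<noteq> 0"
      "qpoch_inf (t3 * z) q \<noteq> 0" "qpoch_inf (t4 * z) q \<noteq> 0" if "z \<in> D" for z
      by (rule qpoch_inf_nonzero [OF norm_q_less_1]; use that in \<open>simp add: D_def\<close>)+
    have nz2: "qpoch_inf (q * a / z) q \<noteq> 0" if "z \<in> D" "norm a < 1" for a z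
      by (rule qpoch_inf_nonzero [OF norm_q_less_1 D' [OF that]])
    have G_hol: "G holomorphic_on D"
      unfolding G_def [abs_def]
      by (intro holomorphic_intros norm_q_less_1 no_zero_divisors nz1 nz2 t D)
    show "F holomorphic_on D"
      unfolding F_def using D s_nonzero
      by (intro holomorphic_intros G_hol holomorphic_on_subset [OF hol]) auto
    fix z :: complex assume z: "\<sigma> \<le> norm z" "norm z \<le> 1"
    have "norm q < \<sigma>"
      using \<sigma> by (simp add: q_def s_def norm_mult)
    moreover have "norm (a * z) < 1" if "norm a < 1" for a :: complex
      using that z(2) mult_left_le [of "norm z" "norm a"] by (simp add: norm_mult)
    ultimately show "z \<in> D"
      using z t by (auto simp: D_def)
  qed
  also have "\<dots> = circ_mean (\<lambda>y. s * (g (s * y) * (y - 1 / y) * R' n y * U' y))"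
  proof (rule circ_mean_cong)
    fix y :: complex assume "norm y = 1"
    then have y: "y \<noteq> 0" by auto
    \<comment> \<open>Under z = s y the product in q/z^2 becomes the one in 1/y^2; its first factor,
      combined with y, yields y - 1/y.\<close>
    have e: "(s * y)\<^sup>2 = q * y\<^sup>2" "q * (1 / (s * y))\<^sup>2 = (1 / y)\<^sup>2" "s * y / s = y"
      "t1 * (s * y) = s * t1 * y" "t2 * (s * y) = s * t2 * y"
      "t3 * (s * y) = s * t3 * y" "t4 * (s * y) = s * t4 * y"
      "q * t1 / (s * y) = s * t1 / y" "q * t2 / (s * y) = s * t2 / y"
      "q * t3 / (s * y) = s * t3 / y" "q * t4 / (s * y) = s * t4 / y"
      using s_nonzero by (simp_all add: q_def power2_eq_square)
    have G: "G (s * y) = (1 - (1 / y)\<^sup>2) * U' y"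
      unfolding G_def aw_U_def e qpoch_inf_step [OF norm_q_less_1, of "(1 / y)\<^sup>2"] by (simp add: mult_ac)
    have y2: "y * (1 - (1 / y)\<^sup>2) = y - 1 / y"
      using y by (simp add: field_simps power2_eq_square)
    show "F (of_real \<sigma> * y) = s * (g (s * y) * (y - 1 / y) * R' n y * U' y)"
      unfolding F_def s_def [symmetric] e G y2 [symmetric] by (simp only: mult_ac)
  qed
  finally have "2 * pair g (S n) = s * (2 * circ_mean (\<lambda>y. g (s * y) * (y - 1 / y) * R' n y * U' y))"
    by (simp only: circ_mean_cmult mult.left_commute)
  \<comment> \<open>Inversion of y is z -> q/z. It fixes \<open>R'\<close> and \<open>U'\<close> and
    changes the sign of y - 1/y, so the two values of \<open>g\<close> are subtracted.\<close>
  also have "2 * circ_mean (\<lambda>y. g (s * y) * (y - 1 / y) * R' n y * U' y)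
    = circ_mean (\<lambda>y. g (s * y) * (y - 1 / y) * R' n y * U' y
        + g (s * (1 / y)) * (1 / y - 1 / (1 / y)) * R' n (1 / y) * U' (1 / y))"
  proof (rule circ_mean_symmetrise)
    have "continuous_on (sphere 0 1) (\<lambda>y. g (s * y))"
      by (rule continuous_on_compose2 [OF holomorphic_on_imp_continuous_on [OF hol]])
        (use s_nonzero in \<open>auto intro!: continuous_intros\<close>)
    then show "continuous_on (sphere 0 1) (\<lambda>y. g (s * y) * (y - 1 / y) * R' n y * U' y)"
      by (intro continuous_intros sh.continuous_R sh.continuous_U) auto
  qed
  finally show ?thesis
    unfolding aw_U_inverse aw_poly_inverse by (simp add: algebra_simps)
qed

text \<open>The square of y - 1/y is -(1 - y^2)(1 - 1/y^2), the factor that separates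
  \<open>U'\<close> from the full weight.\<close>

lemma circ_mean_H':
  "circ_mean (\<lambda>y. (y - 1 / y) * c * R' m y * (y - 1 / y) * R' n y * U' y) = - c * H' m n"
proof -
  have "circ_mean (\<lambda>y. (y - 1 / y) * c * R' m y * (y - 1 / y) * R' n y * U' y)
    = circ_mean (\<lambda>y. - c * (R' m y * R' n y * ((1 - y\<^sup>2) * (1 - (1 / y)\<^sup>2)) * U' y))"
  proof (rule circ_mean_cong)
    fix y :: complex assume "norm y = 1"
    then have "y \<noteq> 0" by auto
    then have sq: "(y - 1 / y) * (y - 1 / y) = - ((1 - y\<^sup>2) * (1 - (1 / y)\<^sup>2))"
      by (simp add: field_simps power2_eq_square)
    have "d * c * r * d * u * v = - c * (r * u * w * v)" if "d * d = - w" for d r u v w :: complex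
    proof -
      have "d * c * r * d * u * v = (d * d) * (c * r * u * v)" by (simp only: mult_ac)
      then show ?thesis using that by (simp add: mult_ac)
    qed
    from this [OF sq] show "(y - 1 / y) * c * R' m y * (y - 1 / y) * R' n y * U' y
      = - c * (R' m y * R' n y * ((1 - y\<^sup>2) * (1 - (1 / y)\<^sup>2)) * U' y)" .
  qed
  then show ?thesis
    unfolding aw_H_def aw_form_def by (simp only: circ_mean_cmult)
qed

text \<open>\<open>R 0\<close> is constant, so the difference in \<open>pair_S_dilate\<close> is
  zero.\<close>

lemma pair_0_S: "pair (R 0) (S n) = 0"
  using pair_S_dilate [OF holomorphic_R, of 0 n] by (simp add: circ_mean_def)

lemma pair_R_S:
  "2 * A * pair (R (Suc m)) (S n)
    = - (q * t1 * (1 - 1 / q ^ Suc m) * (1 - t1 * t2 * t3 * t4 * q ^ Suc m / q)) * H' m n"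
proof -
  define K where "K = t1 * s * (1 - 1 / q ^ Suc m) * (1 - t1 * t2 * t3 * t4 * q ^ Suc m / q) / A"
  have "2 * pair (R (Suc m)) (S n)
    = s * circ_mean (\<lambda>y. (R (Suc m) (s * y) - R (Suc m) (s / y)) * (y - 1 / y) * R' n y * U' y)"
    by (rule pair_S_dilate [OF holomorphic_R])
  also have "\<dots> = s * circ_mean (\<lambda>y. (y - 1 / y) * K * R' m y * (y - 1 / y) * R' n y * U' y)"
    unfolding K_def
    by (intro arg_cong [of _ _ "(*) s"] circ_mean_cong)
       (subst aw_poly_lowering, auto)
  finally show ?thesis
    unfolding circ_mean_H' K_def using A_nonzero q_def by (simp add: field_simps)
qed

text \<open>Since \<open>R'\<close> is invariant under inversion, the difference acts only on z -
  (t3 + t4) + t3 t4/z, where it produces (y - 1/y)(s - t3 t4/s).\<close>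

lemma pair_S_S: "2 * pair (S m) (S n) = - (q - t3 * t4) * H' m n"
proof -
  define K where "K = s - t3 * t4 / s"
  have "2 * pair (S m) (S n)
    = s * circ_mean (\<lambda>y. (S m (s * y) - S m (s / y)) * (y - 1 / y) * R' n y * U' y)"
    by (rule pair_S_dilate [OF holomorphic_S])
  also have "\<dots> = s * circ_mean (\<lambda>y. (y - 1 / y) * K * R' m y * (y - 1 / y) * R' n y * U' y)"
  proof (intro arg_cong [of _ _ "(*) s"] circ_mean_cong)
    fix y :: complex assume "norm y = 1"
    then have y: "y \<noteq> 0" by auto
    have "s / y / s = 1 / y" "s * y / s = y" using s_nonzero by auto
    moreover have "s * y * ((1 - t3 / (s * y)) * (1 - t4 / (s * y)))
        - s / y * ((1 - t3 / (s / y)) * (1 - t4 / (s / y))) = (y - 1 / y) * K"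
      unfolding K_def using s_nonzero y by (simp add: divide_simps) (simp add: algebra_simps)
    ultimately have "S m (s * y) - S m (s / y) = (y - 1 / y) * K * R' m y"
      unfolding cher_S_def aw_poly_inverse by (simp only: left_diff_distrib [symmetric] aw_poly_inverse)
    then show "(S m (s * y) - S m (s / y)) * (y - 1 / y) * R' n y * U' y
      = (y - 1 / y) * K * R' m y * (y - 1 / y) * R' n y * U' y"
      by simp
  qed
  finally show ?thesis
    unfolding circ_mean_H' K_def using s_nonzero by (simp add: q_def algebra_simps)
qed

section \<open>Orthogonality of the two families\<close>

lemma pair_R_R: "2 * pair (R m) (R n) = (1 - t1 * t2) * aw_H q t1 t2 t3 t4 m n"
  unfolding aw_H_def by (rule pair_symmetric) (simp_all add: aw_poly_inverse continuous_R)

lemma pair_R_S': "t1 \<noteq> 0 \<Longrightarrow> 2 * t1 * pair (R m) (S n) = A * aw_H q t1 t2 t3 t4 m (Suc n)"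
  unfolding aw_H_def by (rule pair_symmetric_S) (simp_all add: aw_poly_inverse continuous_R)

lemma aw_H_0_Suc: "t1 \<noteq> 0 \<Longrightarrow> aw_H q t1 t2 t3 t4 0 (Suc n) = 0"
  using pair_R_S' [of 0 n] A_nonzero by (simp add: pair_0_S del: aw_poly_0)

text \<open>\<open>pair (R (Suc m)) (S n)\<close> is a multiple of \<open>H' m n\<close> by the
  moved contour, and a nonzero multiple of the pairing in question by symmetrisation.\<close>

lemma aw_H_Suc_Suc: "t1 \<noteq> 0 \<Longrightarrow> H' m n = 0 \<Longrightarrow> aw_H q t1 t2 t3 t4 (Suc m) (Suc n) = 0"
  using pair_R_S' [of "Suc m" n] pair_R_S [of m n] A_nonzero by simp

end

text \<open>The induction step passes to the shifted parameters, so the parameters are generalised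
  and the locale assumptions enter as a premise of the induction.\<close>

lemma (in cher) aw_H_orthogonal:
  assumes "t1 \<noteq> 0" "m \<noteq> n"
  shows "aw_H q t1 t2 t3 t4 m n = 0"
  using cher_axioms assms
proof (induction n arbitrary: m t1 t2 t3 t4)
  case 0
  then obtain k where "m = Suc k" by (cases m) auto
  then show ?case
    using cher.aw_H_0_Suc [OF 0(1,2), of k] aw_H_commute [of q t1 t2 t3 t4 m 0] by simp
next
  case (Suc n)
  interpret c: cher \<sigma> s q t1 t2 t3 t4 by (rule Suc.prems)
  show ?case
  proof (cases m)
    case 0
    then show ?thesis using c.aw_H_0_Suc Suc.prems by simp
  next
    case (Suc k)
    with Suc.prems have "aw_H q (s * t1) (s * t2) (s * t3) (s * t4) k n = 0"
      using c.s_nonzero by (intro Suc.IH c.shifted) auto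
    then show ?thesis using c.aw_H_Suc_Suc Suc.prems Suc by simp
  qed
qed

context cher
begin

lemma pair_R_R_eq_0: "t1 \<noteq> 0 \<Longrightarrow> m \<noteq> n \<Longrightarrow> pair (R m) (R n) = 0"
  using pair_R_R [of m n] aw_H_orthogonal [of m n] by simp

lemma pair_R_S_eq_0: "t1 \<noteq> 0 \<Longrightarrow> m \<noteq> Suc n \<Longrightarrow> pair (R m) (S n) = 0"
  using pair_R_S' [of m n] aw_H_orthogonal [of m "Suc n"] by simp

lemma pair_S_S_eq_0: "t1 \<noteq> 0 \<Longrightarrow> m \<noteq> n \<Longrightarrow> pair (S m) (S n) = 0"
  using pair_S_S [of m n] cher.aw_H_orthogonal [OF shifted, of m n] s_nonzero by simp

text \<open>The two values of \<open>y\<close> eliminate the norms \<open>h\<close> and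
  \<open>k\<close>, so each of the three terms is a multiple of \<open>A * y\<close>. The multiples
  add up to zero by \<open>e5\<close>.\<close>

lemma orthogonal_same_degree:
  fixes n
  assumes t1: "t1 \<noteq> 0"
  defines "\<alpha> \<equiv> - t1 * (1 - t1 * t2 * t3 * t4 * q ^ n)" and "\<beta> \<equiv> t1\<^sup>2 * t2 * (1 - q ^ Suc n)"
  shows "A * A * pair (R (Suc n)) (R (Suc n)) + A * (\<alpha> + \<beta>) * pair (R (Suc n)) (S n)
    + \<alpha> * \<beta> * pair (S n) (S n) = 0"
proof -
  define x y z h k where "x = pair (R (Suc n)) (R (Suc n))" and "y = pair (R (Suc n)) (S n)"
    and "z = pair (S n) (S n)" and "h = aw_H q t1 t2 t3 t4 (Suc n) (Suc n)" and "k = H' n n"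
  define Q where "Q = q ^ n"
  have Q: "Q \<noteq> 0" "1 - q * Q \<noteq> 0"
    using q_nonzero q_pair_nonzero(1) by (auto simp: Q_def)
  have T: "1 - t1 * t2 * t3 * t4 * Q \<noteq> 0"
    unfolding Q_def by (intro one_minus_mult_power_nonzero norm_q_less_1 norm_mult_less_1 t)
  have xh: "2 * x = (1 - t1 * t2) * h" and yh: "2 * t1 * y = A * h"
    and zk: "2 * z = - (q - t3 * t4) * k"
    unfolding x_def y_def z_def h_def k_def by (rule pair_R_R pair_R_S' [OF t1] pair_S_S)+
  have "2 * A * y = - (q * t1 * (1 - 1 / (q * Q)) * (1 - t1 * t2 * t3 * t4 * Q)) * k"
    using pair_R_S [of n n] q_nonzero by (simp add: y_def k_def Q_def)
  then have yk: "2 * A * y * Q = t1 * (1 - q * Q) * (1 - t1 * t2 * t3 * t4 * Q) * k"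
    using q_nonzero Q by (simp add: divide_simps) (simp add: algebra_simps)
  have "2 * (x * A) = (1 - t1 * t2) * (A * h)"
    using xh by (simp only: mult.assoc [symmetric]) (simp only: mult_ac)
  then have e1: "x * A = t1 * (1 - t1 * t2) * y"
    unfolding yh [symmetric] by simp
  have "2 * (z * (t1 * (1 - q * Q) * (1 - t1 * t2 * t3 * t4 * Q)))
    = - (q - t3 * t4) * (t1 * (1 - q * Q) * (1 - t1 * t2 * t3 * t4 * Q) * k)"
    using zk by (simp only: mult.assoc [symmetric]) (simp only: mult_ac)
  then have e2: "z * (t1 * (1 - q * Q) * (1 - t1 * t2 * t3 * t4 * Q)) = - (q - t3 * t4) * A * y * Q"
    unfolding yk [symmetric] by (simp add: mult.assoc)
  \<comment> \<open>The product of \<alpha> and \<beta> contains exactly the factor that multiplies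
    \<open>z\<close> in \<open>e2\<close>, so nothing has to be divided out.\<close>
  have "\<alpha> * \<beta> * z = - (t1\<^sup>2 * t2) * (z * (t1 * (1 - q * Q) * (1 - t1 * t2 * t3 * t4 * Q)))"
    unfolding \<alpha>_def \<beta>_def by (simp add: Q_def mult_ac)
  then have e3: "\<alpha> * \<beta> * z = t1\<^sup>2 * t2 * (q - t3 * t4) * Q * (A * y)"
    unfolding e2 by (simp add: algebra_simps)
  have e5: "t1 * (1 - t1 * t2) + (\<alpha> + \<beta>) + t1\<^sup>2 * t2 * (q - t3 * t4) * Q = 0"
    by (simp add: \<alpha>_def \<beta>_def Q_def algebra_simps power2_eq_square)
  have e4: "A * A * x = t1 * (1 - t1 * t2) * (A * y)"
    using e1 by (simp add: mult_ac)
  have "A * A * x + A * (\<alpha> + \<beta>) * y + \<alpha> * \<beta> * z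
    = (t1 * (1 - t1 * t2) + (\<alpha> + \<beta>) + t1\<^sup>2 * t2 * (q - t3 * t4) * Q) * (A * y)"
    unfolding e3 e4 by (simp only: mult_ac distrib_left distrib_right)
  then have "A * A * x + A * (\<alpha> + \<beta>) * y + \<alpha> * \<beta> * z = 0"
    unfolding e5 by simp
  then show ?thesis
    unfolding x_def y_def z_def .
qed

end

section \<open>Laurent polynomials and their extreme coefficients\<close>

lemma punctured_add: "punctured f + punctured g = punctured (\<lambda>z. f z + g z)"
  by (auto simp: punctured_def fun_eq_iff)

lemma punctured_cong: "(\<And>z. z \<noteq> 0 \<Longrightarrow> f z = g z) \<Longrightarrow> punctured f = punctured g"
  by (auto simp: punctured_def)

lemma subspace_punctured_add:
  assumes "fun_vs.subspace W" "punctured f \<in> W" "punctured g \<in> W"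
  shows "punctured (\<lambda>z. f z + g z) \<in> W"
  using fun_vs.subspace_add [OF assms] by (simp add: punctured_add)

text \<open>The functions are complex-valued but \<open>fun_vs\<close> is a real vector space;
  complex scalars are therefore restricted to \<real> here and below.\<close>

lemma subspace_punctured_scale:
  assumes "fun_vs.subspace W" "punctured f \<in> W" "c \<in> \<real>"
  shows "punctured (\<lambda>z. c * f z) \<in> W"
proof -
  obtain r where r: "c = of_real r" using assms(3) by (auto elim: Reals_cases)
  have "fun_scale r (punctured f) = punctured (\<lambda>z. c * f z)"
    by (auto simp: r fun_scale_def punctured_def fun_eq_iff scaleR_conv_of_real)
  then show ?thesis
    using fun_vs.subspace_scale [OF assms(1,2), of r] by simp
qed

lemma subspace_punctured_diff:
  assumes "fun_vs.subspace W" "punctured f \<in> W" "punctured g \<in> W"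
  shows "punctured (\<lambda>z. f z - g z) \<in> W"
  using subspace_punctured_add [OF assms(1,2) subspace_punctured_scale [OF assms(1,3), of "-1"]]
  by simp

lemma sum_apply: "(\<Sum>k\<in>K. f k) z = (\<Sum>k\<in>K. f k z)"
  by (induction K rule: infinite_finite_induct) auto

lemma subspace_punctured_sum:
  assumes "fun_vs.subspace W" "\<And>k. k \<in> K \<Longrightarrow> punctured (f k) \<in> W"
  shows "punctured (\<lambda>z. \<Sum>k\<in>K. f k z) \<in> W"
proof -
  have "punctured (\<lambda>z. \<Sum>k\<in>K. f k z) = (\<Sum>k\<in>K. punctured (f k))"
    by (auto simp: punctured_def fun_eq_iff sum_apply)
  then show ?thesis
    using fun_vs.subspace_sum [OF assms] by simp
qed

lemma subspace_laurent_space: "fun_vs.subspace (laurent_space n)"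
  by (simp add: laurent_space_def)

lemma monomial_in_laurent_space:
  "\<bar>k\<bar> \<le> int n \<Longrightarrow> punctured (\<lambda>z. z powi k) \<in> laurent_space n"
  unfolding laurent_space_def by (intro fun_vs.span_base imageI) auto

lemma laurent_space_mono: "m \<le> n \<Longrightarrow> laurent_space m \<subseteq> laurent_space n"
  unfolding laurent_space_def by (intro fun_vs.span_mono image_mono) auto

text \<open>The functions whose product with the multiplier lies in the larger space form a subspace
  \<open>W\<close>, so it suffices to check monomials.\<close>

lemma laurent_space_mult:
  assumes "punctured f \<in> laurent_space n" "a \<in> \<real>" "b \<in> \<real>" "c \<in> \<real>"
  shows "punctured (\<lambda>z. (a * z + b + c / z) * f z) \<in> laurent_space (Suc n)"
proof -
  define W where "W = {h. punctured (\<lambda>z. (a * z + b + c / z) * h z) \<in> laurent_space (Suc n)}"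
  note sub = subspace_laurent_space [of "Suc n"]
  have "fun_vs.subspace W"
  proof (rule fun_vs.subspaceI)
    show "0 \<in> W"
    proof -
      have "punctured (\<lambda>z. (a * z + b + c / z) * (0 :: complex \<Rightarrow> complex) z) = 0"
        by (auto simp: punctured_def fun_eq_iff)
      then show ?thesis using fun_vs.subspace_0 [OF sub] by (simp only: W_def mem_Collect_eq)
    qed
    show "g + h \<in> W" if "g \<in> W" "h \<in> W" for g h
      using subspace_punctured_add [OF sub, of "\<lambda>z. (a * z + b + c / z) * g z"] that
      by (simp add: W_def distrib_left)
    show "fun_scale r h \<in> W" if "h \<in> W" for r h
      using subspace_punctured_scale [OF sub, of "\<lambda>z. (a * z + b + c / z) * h z" "of_real r"] that
      by (simp add: W_def fun_scale_def scaleR_conv_of_real mult.left_commute)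
  qed
  moreover have "punctured (\<lambda>z. z powi k) \<in> W" if k: "\<bar>k\<bar> \<le> int n" for k
  proof -
    have "punctured (\<lambda>z. a * z powi (k + 1) + b * z powi k + c * z powi (k - 1))
      \<in> laurent_space (Suc n)"
      using k assms by (intro subspace_punctured_add subspace_punctured_scale sub
          monomial_in_laurent_space) auto
    also have "punctured (\<lambda>z. a * z powi (k + 1) + b * z powi k + c * z powi (k - 1))
      = punctured (\<lambda>z. (a * z + b + c / z) * punctured (\<lambda>z. z powi k) z)"
      by (rule punctured_cong) (simp add: punctured_def power_int_add power_int_diff algebra_simps)
    finally show ?thesis by (simp add: W_def)
  qed
  then have "(\<lambda>k. punctured (\<lambda>z. z powi k)) ` {- int n..int n} \<subseteq> W"
    by auto
  ultimately have "laurent_space n \<subseteq> W"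
    unfolding laurent_space_def by (intro fun_vs.span_minimal)
  with assms(1) have "punctured (\<lambda>z. (a * z + b + c / z) * punctured f z) \<in> laurent_space (Suc n)"
    by (auto simp: W_def)
  also have "punctured (\<lambda>z. (a * z + b + c / z) * punctured f z)
      = punctured (\<lambda>z. (a * z + b + c / z) * f z)"
    by (rule punctured_cong) (simp add: punctured_def)
  finally show ?thesis .
qed

text \<open>The index is one less than the degree, so that the remainder lies in \<open>laurent_space n\<close>.\<close>
definition extreme_coeffs :: "nat \<Rightarrow> complex \<Rightarrow> complex \<Rightarrow> (complex \<Rightarrow> complex) \<Rightarrow> bool" where
  "extreme_coeffs n a b f \<longleftrightarrow> a \<in> \<real> \<and> b \<in> \<real> \<and>
    punctured (\<lambda>z. f z - a * z powi int (Suc n) - b * z powi (- int (Suc n))) \<in> laurent_space n"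

lemma extreme_coeffs_in_laurent_space:
  assumes "extreme_coeffs n a b f"
  shows "punctured f \<in> laurent_space (Suc n)"
proof -
  let ?W = "laurent_space (Suc n)"
  have "punctured (\<lambda>z. (f z - a * z powi int (Suc n) - b * z powi (- int (Suc n)))
      + a * z powi int (Suc n) + b * z powi (- int (Suc n))) \<in> ?W"
    using assms laurent_space_mono [of n "Suc n"] unfolding extreme_coeffs_def
    by (intro subspace_punctured_add subspace_punctured_scale subspace_laurent_space
        monomial_in_laurent_space) auto
  then show ?thesis by simp
qed

lemma extreme_coeffs_1:
  assumes "a \<in> \<real>" "b \<in> \<real>" "c \<in> \<real>"
  shows "extreme_coeffs 0 a c (\<lambda>z. a * z + b + c / z)"
proof -
  have "punctured (\<lambda>z. b * z powi 0) \<in> laurent_space 0"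
    by (intro subspace_punctured_scale subspace_laurent_space monomial_in_laurent_space assms) auto
  also have "punctured (\<lambda>z. b * z powi 0) =
    punctured (\<lambda>z. a * z + b + c / z - a * z powi int (Suc 0) - c * z powi (- int (Suc 0)))"
    by (rule punctured_cong) (simp add: power_int_minus field_simps)
  finally show ?thesis
    unfolding extreme_coeffs_def using assms by blast
qed

text \<open>Only the outermost products reach exponents n + 2 and -(n + 2). The other four products
  with the extreme monomials have exponents of modulus at most n + 1 and join the remainder.\<close>

lemma extreme_coeffs_mult:
  assumes f: "extreme_coeffs n a b f" and c: "c \<in> \<real>" "d \<in> \<real>" "e \<in> \<real>"
  shows "extreme_coeffs (Suc n) (c * a) (e * b) (\<lambda>z. (c * z + d + e / z) * f z)"
proof -
  let ?N = "int (Suc n)" and ?W = "laurent_space (Suc n)"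
  have ab: "a \<in> \<real>" "b \<in> \<real>" and r: "punctured (\<lambda>z. f z - a * z powi ?N - b * z powi (- ?N)) \<in> laurent_space n"
    using f by (auto simp: extreme_coeffs_def)
  have "punctured (\<lambda>z. (c * z + d + e / z) * (f z - a * z powi ?N - b * z powi (- ?N))
      + (d * a * z powi ?N + e * a * z powi (?N - 1) + c * b * z powi (1 - ?N) + d * b * z powi (- ?N)))
    \<in> ?W"
    using laurent_space_mult [OF r c] c ab
    by (intro subspace_punctured_add subspace_punctured_scale subspace_laurent_space
        monomial_in_laurent_space) auto
  also have "punctured (\<lambda>z. (c * z + d + e / z) * (f z - a * z powi ?N - b * z powi (- ?N))
      + (d * a * z powi ?N + e * a * z powi (?N - 1) + c * b * z powi (1 - ?N) + d * b * z powi (- ?N)))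
    = punctured (\<lambda>z. (c * z + d + e / z) * f z - c * a * z powi int (Suc (Suc n))
        - e * b * z powi (- int (Suc (Suc n))))"
  proof (rule punctured_cong)
    fix z :: complex assume z: "z \<noteq> 0"
    define x y where "x = z powi ?N" and "y = z powi (- ?N)"
    have "z powi (?N - 1) = x / z" "z powi (1 - ?N) = z * y"
      "z powi int (Suc (Suc n)) = z * x" "z powi (- int (Suc (Suc n))) = y / z"
      using z power_int_add [of z "?N" 1] power_int_add [of z "- ?N" 1]
        power_int_diff [of z "- ?N" 1] power_int_diff [of z "?N" 1]
      by (simp_all add: x_def y_def add.commute mult.commute)
    then show "(c * z + d + e / z) * (f z - a * z powi ?N - b * z powi (- ?N))
      + (d * a * z powi ?N + e * a * z powi (?N - 1) + c * b * z powi (1 - ?N) + d * b * z powi (- ?N))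
      = (c * z + d + e / z) * f z - c * a * z powi int (Suc (Suc n))
        - e * b * z powi (- int (Suc (Suc n)))"
      using z unfolding x_def [symmetric] y_def [symmetric] by (simp add: algebra_simps)
  qed
  finally show ?thesis
    unfolding extreme_coeffs_def using c ab by auto
qed

lemma extreme_coeffs_cong:
  assumes "extreme_coeffs n a b f" "\<And>z. z \<noteq> 0 \<Longrightarrow> f z = g z"
  shows "extreme_coeffs n a b g"
proof -
  have "punctured (\<lambda>z. f z - a * z powi int (Suc n) - b * z powi (- int (Suc n)))
    = punctured (\<lambda>z. g z - a * z powi int (Suc n) - b * z powi (- int (Suc n)))"
    by (rule punctured_cong) (simp add: assms(2))
  then show ?thesis using assms(1) by (simp add: extreme_coeffs_def)
qed

lemma extreme_coeffs_scale:
  assumes "extreme_coeffs n a b f" "c \<in> \<real>"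
  shows "extreme_coeffs n (c * a) (c * b) (\<lambda>z. c * f z)"
  using subspace_punctured_scale [OF subspace_laurent_space, of _ n c] assms
  unfolding extreme_coeffs_def by (fastforce simp: algebra_simps)

lemma extreme_coeffs_add_lower:
  assumes "extreme_coeffs n a b f" "punctured g \<in> laurent_space n"
  shows "extreme_coeffs n a b (\<lambda>z. g z + f z)"
  using subspace_punctured_add [OF subspace_laurent_space, of g n] assms
  unfolding extreme_coeffs_def by (fastforce simp: algebra_simps)

lemma qpoch_in_Reals: "a \<in> \<real> \<Longrightarrow> q \<in> \<real> \<Longrightarrow> qpoch a q k \<in> \<real>"
  by (induction k) (auto simp: qpoch_Suc)

text \<open>The factors with index i combine to the multiplier -t q^i z + const - u q^i/z. The
  parameters t and u are separate because \<open>S\<close> leads to u = q t.\<close>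

lemma extreme_coeffs_qpoch:
  assumes "t \<in> \<real>" "u \<in> \<real>" "q \<in> \<real>"
  shows "extreme_coeffs n (\<Prod>i\<le>n. - t * q ^ i) (\<Prod>i\<le>n. - u * q ^ i)
    (\<lambda>z. qpoch (t * z) q (Suc n) * qpoch (u / z) q (Suc n))"
proof (induction n)
  case 0
  have "extreme_coeffs 0 (- t) (- u) (\<lambda>z. - t * z + (1 + t * u) + - u / z)"
    using assms by (intro extreme_coeffs_1) auto
  then have "extreme_coeffs 0 (- t) (- u) (\<lambda>z. qpoch (t * z) q (Suc 0) * qpoch (u / z) q (Suc 0))"
    by (rule extreme_coeffs_cong) (simp add: qpoch_Suc algebra_simps)
  then show ?case by simp
next
  case (Suc n)
  have "extreme_coeffs (Suc n) (- t * q ^ Suc n * (\<Prod>i\<le>n. - t * q ^ i)) (- u * q ^ Suc n * (\<Prod>i\<le>n. - u * q ^ i))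
    (\<lambda>z. (- t * q ^ Suc n * z + (1 + t * q ^ Suc n * (u * q ^ Suc n)) + - u * q ^ Suc n / z)
      * (qpoch (t * z) q (Suc n) * qpoch (u / z) q (Suc n)))"
    using assms by (intro extreme_coeffs_mult Suc.IH) auto
  moreover have "- t * q ^ Suc n * (\<Prod>i\<le>n. - t * q ^ i) = (\<Prod>i\<le>Suc n. - t * q ^ i)" for t
    by (simp add: mult.commute)
  ultimately have "extreme_coeffs (Suc n) (\<Prod>i\<le>Suc n. - t * q ^ i) (\<Prod>i\<le>Suc n. - u * q ^ i)
    (\<lambda>z. (- t * q ^ Suc n * z + (1 + t * q ^ Suc n * (u * q ^ Suc n)) + - u * q ^ Suc n / z)
      * (qpoch (t * z) q (Suc n) * qpoch (u / z) q (Suc n)))"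
    by metis
  then show ?case
  proof (rule extreme_coeffs_cong)
    fix z :: complex assume z: "z \<noteq> 0"
    have "- t * q ^ Suc n * z + (1 + t * q ^ Suc n * (u * q ^ Suc n)) + - u * q ^ Suc n / z
      = (1 - t * z * q ^ Suc n) * (1 - u / z * q ^ Suc n)"
      using z by (simp add: algebra_simps)
    then show "(- t * q ^ Suc n * z + (1 + t * q ^ Suc n * (u * q ^ Suc n)) + - u * q ^ Suc n / z)
      * (qpoch (t * z) q (Suc n) * qpoch (u / z) q (Suc n))
      = qpoch (t * z) q (Suc (Suc n)) * qpoch (u / z) q (Suc (Suc n))"
      unfolding qpoch_Suc [of _ q "Suc n"] by (simp only: mult_ac)
  qed
qed

lemma qpoch_in_laurent_space:
  assumes "t \<in> \<real>" "u \<in> \<real>" "q \<in> \<real>" "k \<le> n"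
  shows "punctured (\<lambda>z. qpoch (t * z) q k * qpoch (u / z) q k) \<in> laurent_space n"
proof (cases k)
  case 0
  then show ?thesis using monomial_in_laurent_space [of 0 n] by simp
next
  case (Suc m)
  then show ?thesis
    using extreme_coeffs_in_laurent_space [OF extreme_coeffs_qpoch [OF assms(1-3), of m]]
      laurent_space_mono [OF assms(4)] by auto
qed

text \<open>Only the last summand has degree n + 1; all others belong to
  \<open>laurent_space n\<close>.\<close>

lemma extreme_coeffs_qpoch_sum:
  assumes "t \<in> \<real>" "u \<in> \<real>" "q \<in> \<real>" "\<And>k. c k \<in> \<real>"
  shows "extreme_coeffs n (c (Suc n) * (\<Prod>i\<le>n. - t * q ^ i)) (c (Suc n) * (\<Prod>i\<le>n. - u * q ^ i))
    (\<lambda>z. \<Sum>k\<le>Suc n. c k * (qpoch (t * z) q k * qpoch (u / z) q k))"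
  unfolding sum.atMost_Suc
  by (intro extreme_coeffs_add_lower extreme_coeffs_scale extreme_coeffs_qpoch assms
      subspace_punctured_sum subspace_punctured_scale subspace_laurent_space qpoch_in_laurent_space) auto

section \<open>Spanning and independence\<close>

text \<open>Modulo \<open>laurent_space n\<close>, f and g are combinations of the two new monomials
  with determinant \<open>a * d - b * c\<close>, and Cramer's rule recovers both monomials.\<close>

lemma laurent_space_Suc_subset:
  assumes W: "fun_vs.subspace W" "laurent_space n \<subseteq> W" "punctured f \<in> W" "punctured g \<in> W"
    and f: "extreme_coeffs n a b f" and g: "extreme_coeffs n c d g" and det: "a * d - b * c \<noteq> 0"
  shows "laurent_space (Suc n) \<subseteq> W"
proof -
  let ?x = "\<lambda>z :: complex. z powi int (Suc n)" and ?y = "\<lambda>z :: complex. z powi (- int (Suc n))"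
  have r: "a \<in> \<real>" "b \<in> \<real>" "c \<in> \<real>" "d \<in> \<real>"
    using f g by (auto simp: extreme_coeffs_def)
  have top: "punctured (\<lambda>z. a * ?x z + b * ?y z) \<in> W" if "extreme_coeffs n a b f" "punctured f \<in> W" for a b f
  proof -
    have "punctured (\<lambda>z. f z - (f z - a * ?x z - b * ?y z)) \<in> W"
      by (rule subspace_punctured_diff [OF W(1) that(2)])
        (use that(1) W(2) in \<open>auto simp: extreme_coeffs_def\<close>)
    then show ?thesis by simp
  qed
  note F = top [OF f W(3)] and G = top [OF g W(4)]
  define D where "D = a * d - b * c"
  have D: "inverse D \<in> \<real>" "D \<noteq> 0" using r det by (auto simp: D_def)
  have "punctured (\<lambda>z. inverse D * (d * (a * ?x z + b * ?y z) - b * (c * ?x z + d * ?y z))) \<in> W"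
    by (rule subspace_punctured_scale [OF W(1) subspace_punctured_diff [OF W(1)
          subspace_punctured_scale [OF W(1)] subspace_punctured_scale [OF W(1)]]]) (rule F G r D)+
  also have "(\<lambda>z. inverse D * (d * (a * ?x z + b * ?y z) - b * (c * ?x z + d * ?y z))) = ?x"
  proof
    fix z
    have "d * (a * ?x z + b * ?y z) - b * (c * ?x z + d * ?y z) = D * ?x z"
      by (simp add: D_def algebra_simps)
    then show "inverse D * (d * (a * ?x z + b * ?y z) - b * (c * ?x z + d * ?y z)) = ?x z"
      using D(2) by simp
  qed
  finally have x: "punctured ?x \<in> W" .
  have "punctured (\<lambda>z. inverse D * (a * (c * ?x z + d * ?y z) - c * (a * ?x z + b * ?y z))) \<in> W"
    by (rule subspace_punctured_scale [OF W(1) subspace_punctured_diff [OF W(1)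
          subspace_punctured_scale [OF W(1)] subspace_punctured_scale [OF W(1)]]]) (rule F G r D)+
  also have "(\<lambda>z. inverse D * (a * (c * ?x z + d * ?y z) - c * (a * ?x z + b * ?y z))) = ?y"
  proof
    fix z
    have "a * (c * ?x z + d * ?y z) - c * (a * ?x z + b * ?y z) = D * ?y z"
      by (simp add: D_def algebra_simps)
    then show "inverse D * (a * (c * ?x z + d * ?y z) - c * (a * ?x z + b * ?y z)) = ?y z"
      using D(2) by simp
  qed
  finally have y: "punctured ?y \<in> W" .
  show ?thesis
    unfolding laurent_space_def
  proof (rule fun_vs.span_minimal [OF _ W(1)], safe)
    fix k assume k: "k \<in> {- int (Suc n)..int (Suc n)}"
    then consider "k = int (Suc n)" | "k = - int (Suc n)" | "\<bar>k\<bar> \<le> int n"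
      by fastforce
    then show "punctured (\<lambda>z. z powi k) \<in> W"
    proof cases
      case 3
      then show ?thesis using monomial_in_laurent_space W(2) by blast
    qed (use x y in simp_all)
  qed
qed

lemma inj_monomial: "inj (\<lambda>k. punctured (\<lambda>z. z powi k))"
proof
  fix k l assume "punctured (\<lambda>z. z powi k) = punctured (\<lambda>z. z powi l)"
  then have "norm (punctured (\<lambda>z. z powi k) 2) = norm (punctured (\<lambda>z. z powi l) 2)" by simp
  then have "(2 :: real) powi k = 2 powi l"
    by (simp add: punctured_def norm_power_int)
  then show "k = l"
    using power_int_strict_increasing [of k l "2 :: real"] power_int_strict_increasing [of l k "2 :: real"]
    by (cases k l rule: linorder_cases) auto
qed

text \<open>Multiplied by z^n, a vanishing combination becomes a polynomial of degree at most 2n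
  that is zero at every z \<noteq> 0, so all its coefficients vanish; \<open>c i\<close> is the one
  of exponent i - n.\<close>

lemma independent_monomials:
  "fun_vs.independent ((\<lambda>k. punctured (\<lambda>z. z powi k)) ` {- int n..int n})"
  (is "fun_vs.independent (?e ` ?K)")
proof
  assume "fun_vs.dependent (?e ` ?K)"
  then obtain u v where v: "v \<in> ?K" "u (?e v) \<noteq> 0"
    and "(\<Sum>h\<in>?e ` ?K. fun_scale (u h) h) = 0"
    using fun_vs.dependent_finite [of "?e ` ?K"] by auto
  then have s_nonzero: "(\<Sum>k\<in>?K. fun_scale (u (?e k)) (?e k)) = 0"
    by (simp add: sum.reindex [OF inj_on_subset [OF inj_monomial]] o_def)
  define c where "c i = complex_of_real (u (?e (int i - int n)))" for i
  have "(\<Sum>i\<le>2 * n. c i * z ^ i) = 0" if z: "z \<noteq> 0" for z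
  proof -
    have "(\<Sum>i\<le>2 * n. c i * z ^ i) = (\<Sum>k\<in>?K. of_real (u (?e k)) * z powi (k + int n))"
      by (rule sum.reindex_bij_witness [of _ "\<lambda>k. nat (k + int n)" "\<lambda>i. int i - int n"])
         (auto simp: c_def)
    also have "\<dots> = z ^ n * (\<Sum>k\<in>?K. fun_scale (u (?e k)) (?e k)) z"
      using z by (simp add: sum_apply sum_distrib_left fun_scale_def punctured_def power_int_add
          scaleR_conv_of_real mult_ac)
    finally show ?thesis by (simp add: s_nonzero)
  qed
  then have "- {0} \<subseteq> {z. (\<Sum>i\<le>2 * n. c i * z ^ i) = 0}" by auto
  moreover have "infinite (- {0 :: complex})"
    by (simp add: finite_compl infinite_UNIV_char_0)
  ultimately have "infinite {z. (\<Sum>i\<le>2 * n. c i * z ^ i) = 0}"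
    using finite_subset by blast
  then have "c (nat (v + int n)) = 0"
    unfolding polyfun_finite_roots using v(1) by auto
  with v show False by (simp add: c_def)
qed

text \<open>Dimension count: by independence of the 2n + 1 monomials, no smaller set spans, so a
  spanning family with 2n + 1 indices has neither repeated nor redundant members.\<close>

lemma spanning_family_is_basis:
  assumes sub: "x ` {- int n..int n} \<subseteq> laurent_space n"
    and span: "laurent_space n \<subseteq> fun_vs.span (x ` {- int n..int n})"
  shows "inj_on x {- int n..int n}" "fun_vs.independent (x ` {- int n..int n})"
    "fun_vs.span (x ` {- int n..int n}) = laurent_space n"
proof -
  let ?K = "{- int n..int n}" and ?e = "\<lambda>k. punctured (\<lambda>z. z powi k)"
  have card_le: "card ?K \<le> card T" if "finite T" "laurent_space n \<subseteq> fun_vs.span T" for T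
  proof -
    have "?e ` ?K \<subseteq> fun_vs.span T"
      using that(2) fun_vs.span_superset unfolding laurent_space_def by blast
    then have "card (?e ` ?K) \<le> card T"
      using fun_vs.independent_span_bound [OF that(1) independent_monomials] by blast
    then show ?thesis
      by (simp add: card_image [OF inj_on_subset [OF inj_monomial]])
  qed
  have card: "card (x ` ?K) = card ?K"
    by (intro antisym card_image_le card_le span) auto
  then show "inj_on x ?K" by (simp add: eq_card_imp_inj_on)
  show "fun_vs.independent (x ` ?K)"
  proof
    assume "fun_vs.dependent (x ` ?K)"
    then obtain a where a: "a \<in> x ` ?K" "a \<in> fun_vs.span (x ` ?K - {a})"
      by (auto simp: fun_vs.dependent_def)
    then have "fun_vs.span (x ` ?K - {a}) = fun_vs.span (x ` ?K)"
      by (metis fun_vs.span_redundant insert_Diff)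
    with span have "card ?K \<le> card (x ` ?K - {a})"
      by (intro card_le) auto
    also have "\<dots> < card (x ` ?K)"
      using a(1) by (intro psubset_card_mono) auto
    finally show False using card by simp
  qed
  show "fun_vs.span (x ` ?K) = laurent_space n"
    using span fun_vs.span_minimal [OF sub subspace_laurent_space] by blast
qed

section \<open>The orthogonal basis\<close>

lemma aw_coeff_in_Reals:
  "q \<in> \<real> \<Longrightarrow> t1 \<in> \<real> \<Longrightarrow> t2 \<in> \<real> \<Longrightarrow> t3 \<in> \<real> \<Longrightarrow> t4 \<in> \<real> \<Longrightarrow> aw_coeff q t1 t2 t3 t4 n k \<in> \<real>"
  unfolding aw_coeff_def
  by (intro Reals_mult Reals_divide qpoch_in_Reals Reals_power Reals_1)

lemma (in cher) aw_coeff_top_nonzero: "aw_coeff q t1 t2 t3 t4 n n \<noteq> 0"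
proof -
  have "qpoch (1 / q ^ n) q n \<noteq> 0"
  proof -
    have "1 - 1 / q ^ n * q ^ i \<noteq> 0" if "i < n" for i
    proof
      assume "1 - 1 / q ^ n * q ^ i = 0"
      then have "norm (q ^ i) = norm (q ^ n)" using q_nonzero by (simp add: field_simps)
      moreover have "norm q ^ n < norm q ^ i"
        using that norm_q_less_1 q_nonzero by (intro power_strict_decreasing) auto
      ultimately show False by (simp add: norm_power)
    qed
    then show ?thesis using q_nonzero by (auto simp: qpoch_def)
  qed
  moreover have "qpoch (t1 * t2 * t3 * t4 * q ^ n / q) q n \<noteq> 0"
  proof (cases n)
    \<comment> \<open>For n = 0 the product is empty; for n = k + 1 its parameter is t1 t2 t3 t4
      q^k, of modulus below 1.\<close>
    case (Suc k)
    have "norm (q ^ k) \<le> 1" using norm_q_less_1 by (simp add: norm_power power_le_one)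
    then have "norm (t1 * t2 * t3 * t4 * q ^ k) < 1"
      using norm_mult_less_1 [OF norm_mult_less_1 [OF norm_mult_less_1 [OF t(1,2)] t(3)] t(4)]
      by (metis mult_le_cancel_left1 norm_mult order_le_less_trans mult_left_le norm_ge_zero)
    then have "qpoch (t1 * t2 * t3 * t4 * q ^ k) q n \<noteq> 0" by (rule qpoch_nonzero [OF norm_q_less_1])
    moreover have "t1 * t2 * t3 * t4 * q ^ n / q = t1 * t2 * t3 * t4 * q ^ k"
      using Suc q_nonzero by simp
    ultimately show ?thesis by simp
  qed simp
  ultimately show ?thesis
    unfolding aw_coeff_def using q_nonzero norm_q_less_1 t by (simp add: qpoch_nonzero norm_mult_less_1)
qed

text \<open>Real parameters make all coefficients real, as membership in a real span
  requires.\<close>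

locale real_cher = cher +
  assumes real: "t1 \<in> \<real>" "t2 \<in> \<real>" "t3 \<in> \<real>" "t4 \<in> \<real>"
begin

lemma s_real: "s \<in> \<real>" and q_real: "q \<in> \<real>"
  by (auto simp: s_def q_def)

lemma R_extreme_coeffs:
  assumes "t1 \<noteq> 0"
  obtains r where "r \<noteq> 0" "extreme_coeffs n r r (R (Suc n))"
proof
  let ?r = "aw_coeff q t1 t2 t3 t4 (Suc n) (Suc n) * (\<Prod>i\<le>n. - t1 * q ^ i)"
  show "?r \<noteq> 0"
    using aw_coeff_top_nonzero q_nonzero assms by simp
  show "extreme_coeffs n ?r ?r (R (Suc n))"
    unfolding aw_poly_def [abs_def]
    by (intro extreme_coeffs_qpoch_sum aw_coeff_in_Reals real q_real)
qed

lemma R_in_laurent_space: "m \<le> n \<Longrightarrow> punctured (R m) \<in> laurent_space n"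
  unfolding aw_poly_def [abs_def]
  by (intro subspace_punctured_sum subspace_punctured_scale subspace_laurent_space
      qpoch_in_laurent_space aw_coeff_in_Reals real q_real) auto

text \<open>The sum \<open>g\<close> has extreme coefficients in ratio q^n, since replacing t1 by q
  t1 in the factors with 1/z contributes one q for each of n factors. The prefactor z - (t3 + t4) +
  t3 t4/z contributes t3 t4.\<close>

lemma S_extreme_coeffs:
  assumes "t1 \<noteq> 0"
  obtains p where "p \<noteq> 0" "extreme_coeffs n p (t3 * t4 * q ^ n * p) (S n)"
proof -
  interpret sh: cher \<sigma> s q "s * t1" "s * t2" "s * t3" "s * t4" by (rule shifted)
  define c where "c = aw_coeff q (s * t1) (s * t2) (s * t3) (s * t4) n"
  define g where "g z = (\<Sum>k\<le>n. c k * (qpoch (t1 * z) q k * qpoch (q * t1 / z) q k))" for z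
  have c: "c k \<in> \<real>" for k
    unfolding c_def by (intro aw_coeff_in_Reals Reals_mult real s_real q_real)
  have S_eq: "(1 * z + - (t3 + t4) + t3 * t4 / z) * g z = S n z" if "z \<noteq> 0" for z
  proof -
    have e: "s * t1 / (z / s) = q * t1 / z" "s * t1 * (z / s) = t1 * z"
      using s_nonzero that by (auto simp: q_def)
    have "R' n (z / s) = g z" unfolding aw_poly_def g_def c_def e ..
    moreover have "1 * z + - (t3 + t4) + t3 * t4 / z = z * ((1 - t3 / z) * (1 - t4 / z))"
      using that by (simp add: field_simps)
    ultimately show ?thesis by (simp add: cher_S_def)
  qed
  show ?thesis
  proof (cases n)
    \<comment> \<open>Here \<open>g\<close> is the constant 1, while
      \<open>extreme_coeffs_qpoch_sum\<close> only covers top index at least 1.\<close>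
    case 0
    have "extreme_coeffs 0 1 (t3 * t4) (\<lambda>z. 1 * z + - (t3 + t4) + t3 * t4 / z)"
      by (intro extreme_coeffs_1 Reals_1 Reals_minus Reals_add Reals_mult real)
    then have "extreme_coeffs 0 1 (t3 * t4) (S n)"
      by (rule extreme_coeffs_cong)
        (use S_eq 0 in \<open>simp add: g_def c_def aw_coeff_def\<close>)
    then show ?thesis using that [of 1] 0 by simp
  next
    case (Suc m)
    define p where "p = c n * (\<Prod>i\<le>m. - t1 * q ^ i)"
    have "extreme_coeffs m p (c n * (\<Prod>i\<le>m. - (q * t1) * q ^ i)) g"
      unfolding p_def g_def Suc
      by (intro extreme_coeffs_qpoch_sum c real q_real Reals_mult)
    also have "(\<Prod>i\<le>m. - (q * t1) * q ^ i) = (\<Prod>i\<le>m. q * (- t1 * q ^ i))"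
      by (simp add: mult_ac)
    also have "\<dots> = q ^ n * (\<Prod>i\<le>m. - t1 * q ^ i)"
      unfolding prod.distrib by (simp add: Suc)
    finally have "extreme_coeffs m p (c n * (q ^ n * (\<Prod>i\<le>m. - t1 * q ^ i))) g" .
    then have "extreme_coeffs (Suc m) (1 * p) (t3 * t4 * (c n * (q ^ n * (\<Prod>i\<le>m. - t1 * q ^ i))))
      (\<lambda>z. (1 * z + - (t3 + t4) + t3 * t4 / z) * g z)"
      by (intro extreme_coeffs_mult Reals_1 Reals_minus Reals_add Reals_mult real)
    also have "t3 * t4 * (c n * (q ^ n * (\<Prod>i\<le>m. - t1 * q ^ i))) = t3 * t4 * q ^ n * p"
      unfolding p_def by (simp only: mult_ac)
    finally have "extreme_coeffs n p (t3 * t4 * q ^ n * p) (S n)"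
      unfolding Suc mult_1 by (rule extreme_coeffs_cong) (use S_eq Suc in simp)
    moreover have "p \<noteq> 0"
      unfolding p_def c_def using sh.aw_coeff_top_nonzero q_nonzero assms by simp
    ultimately show ?thesis by (rule that [rotated])
  qed
qed

lemma laurent_space_subset:
  assumes "t1 \<noteq> 0" and W: "fun_vs.subspace W"
    and "\<And>m. m \<le> n \<Longrightarrow> punctured (R m) \<in> W" "\<And>m. m < n \<Longrightarrow> punctured (S m) \<in> W"
  shows "laurent_space n \<subseteq> W"
  using assms(3,4)
proof (induction n)
  case 0
  have "punctured (\<lambda>z. z powi 0) \<in> W"
    using 0(1) [of 0] by (simp add: punctured_def)
  then show ?case
    unfolding laurent_space_def by (intro fun_vs.span_minimal W) auto
next
  case (Suc n)
  obtain r where r: "r \<noteq> 0" "extreme_coeffs n r r (R (Suc n))"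
    using R_extreme_coeffs [OF assms(1)] .
  obtain p where p: "p \<noteq> 0" "extreme_coeffs n p (t3 * t4 * q ^ n * p) (S n)"
    using S_extreme_coeffs [OF assms(1)] .
  show ?case
  proof (rule laurent_space_Suc_subset [OF W _ _ _ r(2) p(2)])
    \<comment> \<open>The determinant is nonzero because |t3 t4 q^n| < 1.\<close>
    have "r * (t3 * t4 * q ^ n * p) - r * p = - (r * p * (1 - t3 * t4 * q ^ n))"
      by (simp add: algebra_simps)
    then show "r * (t3 * t4 * q ^ n * p) - r * p \<noteq> 0"
      using r(1) p(1) one_minus_mult_power_nonzero [OF norm_q_less_1 norm_mult_less_1 [OF t(3,4)]] by simp
  qed (use Suc in simp_all)
qed

lemma S_in_laurent_space:
  assumes "t1 \<noteq> 0" "m < n"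
  shows "punctured (S m) \<in> laurent_space n"
proof -
  obtain p where "extreme_coeffs m p (t3 * t4 * q ^ m * p) (S m)"
    using S_extreme_coeffs [OF assms(1)] .
  then show ?thesis
    using extreme_coeffs_in_laurent_space laurent_space_mono [of "Suc m" n] assms(2) by auto
qed

end

section \<open>Translation of the original definitions\<close>

lemma phi43_eq_sum:
  assumes "q \<noteq> 0"
  shows "phi43 (1 / q ^ n) a b c d e f q q
    = (\<Sum>k\<le>n. qpoch (1 / q ^ n) q k * qpoch a q k / (qpoch q q k * qpoch d q k * qpoch e q k * qpoch f q k)
        * q ^ k * (qpoch b q k * qpoch c q k))"
  unfolding phi43_def
  by (subst suminf_finite [of "{..n}"])
     (auto simp: qpoch_eq_0 assms not_le mult_ac intro!: sum.cong)

lemma AW_R_eq: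
  fixes t1 t2 t3 t4 q :: real
  assumes "q \<noteq> 0"
  shows "AW_R t1 t2 t3 t4 q n z
    = aw_poly (of_real q) (of_real t1) (of_real t2) (of_real t3) (of_real t4) n z"
proof -
  have e: "complex_of_real (q powi (- int n)) = 1 / of_real q ^ n"
    "complex_of_real (t1 * t2 * t3 * t4 * q powi (int n - 1))
      = of_real t1 * of_real t2 * of_real t3 * of_real t4 * of_real q ^ n / of_real q"
    using assms by (simp_all add: power_int_minus power_int_diff divide_inverse)
  show ?thesis
    unfolding AW_R_def e
    by (subst phi43_eq_sum) (use assms in \<open>simp_all add: aw_poly_def aw_coeff_def\<close>)
qed

lemma AW_S_eq:
  fixes t1 t2 t3 t4 q :: real
  assumes "q > 0" "z \<noteq> 0"
  shows "AW_S t1 t2 t3 t4 q (Suc n) z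
    = cher_S (of_real (sqrt q)) (of_real q) (of_real t1) (of_real t2) (of_real t3) (of_real t4) n z"
proof -
  define s where "s = complex_of_real (sqrt q)"
  have s: "s \<noteq> 0" "complex_of_real q = s * s"
    using assms by (simp_all add: s_def flip: of_real_mult)
  have e: "complex_of_real (q powi (1 - int (Suc n))) = 1 / of_real q ^ n"
    using assms by (simp add: power_int_minus divide_inverse)
  \<comment> \<open>The four factors \<open>s\<close> multiply to q^2, which turns q^n / q into
    q^(n+1).\<close>
  have e2: "complex_of_real (t1 * t2 * t3 * t4 * q ^ Suc n)
      = s * of_real t1 * (s * of_real t2) * (s * of_real t3) * (s * of_real t4) * of_real q ^ n / of_real q"
    "of_real t1 * z = s * of_real t1 * (z / s)" "of_real (q * t1) / z = s * of_real t1 / (z / s)"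
    "complex_of_real (q * t1 * t2) = s * of_real t1 * (s * of_real t2)"
    "complex_of_real (q * t1 * t3) = s * of_real t1 * (s * of_real t3)"
    "complex_of_real (q * t1 * t4) = s * of_real t1 * (s * of_real t4)"
    using assms s(1) by (simp_all add: s(2))
  show ?thesis
    unfolding AW_S_def e e2 s_def [symmetric]
    by (subst phi43_eq_sum) (use assms in \<open>simp_all add: cher_S_def aw_poly_def aw_coeff_def\<close>)
qed

lemma w_cher_eq:
  "w_cher t1 t2 t3 t4 q z
    = cher_weight (of_real q) (of_real t1) (of_real t2) (of_real t3) (of_real t4) z"
proof -
  have "z powi - 2 = (1 / z)\<^sup>2"
    by (simp add: power_int_minus power_one_over power_inverse divide_inverse)
  then show ?thesis
    by (simp add: w_cher_def cher_weight_def Let_def mult_ac)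
qed

text \<open>For \<open>t1 = 0\<close> all factors involving \<open>z\<close> are \<open>1\<close>, and the remaining sum telescopes.\<close>
lemma aw_poly_zero_param:
  assumes "q \<noteq> 0" "norm q < 1"
  shows "aw_poly q 0 t2 t3 t4 (Suc n) z = 0"
proof -
  have one: "qpoch 0 q k = 1" for k by (simp add: qpoch_def)
  have telescope: "(\<Sum>k\<le>N. qpoch a q k / qpoch q q k * q ^ k) = qpoch (q * a) q N / qpoch q q N" for a N
  proof (induction N)
    case (Suc N)
    have nz: "qpoch q q N \<noteq> 0" "1 - q * q ^ N \<noteq> 0"
      by (intro qpoch_nonzero one_minus_mult_power_nonzero assms(2))+
    have "qpoch (q * a) q N / qpoch q q N + qpoch a q (Suc N) / qpoch q q (Suc N) * q ^ Suc N
      = qpoch (q * a) q (Suc N) / qpoch q q (Suc N)"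
      unfolding qpoch_Suc_shift [of a] qpoch_Suc [of "q * a"] qpoch_Suc [of q]
      using nz by (simp add: divide_simps) (simp add: algebra_simps)
    then show ?case by (simp only: sum.atMost_Suc Suc.IH)
  qed simp
  have "aw_poly q 0 t2 t3 t4 (Suc n) z = qpoch (q * (1 / q ^ Suc n)) q (Suc n) / qpoch q q (Suc n)"
    unfolding aw_poly_def aw_coeff_def using telescope [of "1 / q ^ Suc n" "Suc n"]
    by (simp add: one)
  \<comment> \<open>The numerator is thus the factorial of q^(-n) of length n + 1, which is
    zero.\<close>
  also have "q * (1 / q ^ Suc n) = 1 / q ^ n" using assms by simp
  finally show ?thesis using assms by (simp add: qpoch_eq_0)
qed

text \<open>The signed coefficient of S in \<open>cher_X\<close>. It vanishes at j = 0, so the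
  truncated index \<open>nat \<bar>j\<bar> - 1\<close> in \<open>cher_X_eq\<close> does no harm
  there.\<close>

definition X_coeff :: "complex \<Rightarrow> complex \<Rightarrow> complex \<Rightarrow> complex \<Rightarrow> complex \<Rightarrow> int \<Rightarrow> complex" where
  "X_coeff q t1 t2 t3 t4 j =
    (if j < 0 then - t1 * (1 - t1 * t2 * t3 * t4 * q ^ (nat \<bar>j\<bar> - 1))
     else t1\<^sup>2 * t2 * (1 - q ^ nat \<bar>j\<bar>))"

lemma X_coeff_0 [simp]: "X_coeff q t1 t2 t3 t4 0 = 0"
  by (simp add: X_coeff_def)

lemma cher_X_eq:
  fixes t1 t2 t3 t4 q :: real
  assumes "q > 0"
  defines "Q \<equiv> complex_of_real q" and "u1 \<equiv> complex_of_real t1" and "u2 \<equiv> complex_of_real t2"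
    and "u3 \<equiv> complex_of_real t3" and "u4 \<equiv> complex_of_real t4"
  shows "cher_X t1 t2 t3 t4 q j = punctured (\<lambda>z. aw_A u1 u2 u3 u4 * aw_poly Q u1 u2 u3 u4 (nat \<bar>j\<bar>) z
    + X_coeff Q u1 u2 u3 u4 j * cher_S (of_real (sqrt q)) Q u1 u2 u3 u4 (nat \<bar>j\<bar> - 1) z)"
  unfolding cher_X_def Let_def
proof (rule punctured_cong, goal_cases)
  case (1 z)
  have A: "complex_of_real ((1 - t1 * t2) * (1 - t1 * t3) * (1 - t1 * t4)) = aw_A u1 u2 u3 u4"
    by (simp add: aw_A_def u1_def u2_def u3_def u4_def)
  have R: "AW_R t1 t2 t3 t4 q m z = aw_poly Q u1 u2 u3 u4 m z" for m
    using AW_R_eq [of q] assms(1) by (simp add: Q_def u1_def u2_def u3_def u4_def)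
  show ?case
  proof (cases "nat \<bar>j\<bar>")
    case 0
    then have "j = 0" by simp
    then show ?thesis unfolding 0 A R by simp
  next
    case (Suc m)
    have S: "AW_S t1 t2 t3 t4 q (Suc m) z = cher_S (of_real (sqrt q)) Q u1 u2 u3 u4 m z"
      using AW_S_eq [OF assms(1) 1] by (simp add: Q_def u1_def u2_def u3_def u4_def)
    show ?thesis
      unfolding Suc A R S X_coeff_def by (simp add: Q_def u1_def u2_def u3_def u4_def)
  qed
qed

section \<open>Orthogonality and span of the family X\<close>

context cher
begin

abbreviation "X j \<equiv> (\<lambda>z. A * R (nat \<bar>j\<bar>) z
  + X_coeff q t1 t2 t3 t4 j * S (nat \<bar>j\<bar> - 1) z)"

lemma X_orthogonal:
  assumes "i \<noteq> j"
  shows "pair (X i) (X j) = 0"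
proof (cases "t1 = 0")
  case True
  \<comment> \<open>For t1 = 0 every member except the one with index 0 is the zero function, so
    orthogonality is trivial.\<close>
  have "X k z = 0" if k: "k \<noteq> 0" for k z
  proof -
    obtain m where "nat \<bar>k\<bar> = Suc m" using k by (cases "nat \<bar>k\<bar>") auto
    then show ?thesis
      using aw_poly_zero_param [OF q_nonzero norm_q_less_1] by (simp add: True X_coeff_def)
  qed
  moreover have "i \<noteq> 0 \<or> j \<noteq> 0" using assms by auto
  ultimately have "X i z * X j z = 0" for z by (metis mult_eq_0_iff)
  then show ?thesis
    unfolding cher_pair_def by (simp only: mult_zero_left) (simp add: circ_mean_def)
next
  case t1: False
  define m n where "m = nat \<bar>i\<bar>" and "n = nat \<bar>j\<bar>"
  define a b where "a = X_coeff q t1 t2 t3 t4 i" and "b = X_coeff q t1 t2 t3 t4 j"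
  have expand: "pair (X i) (X j) = A * A * pair (R m) (R n) + A * b * pair (R m) (S (n - 1))
      + a * A * pair (S (m - 1)) (R n) + a * b * pair (S (m - 1)) (S (n - 1))"
    unfolding m_def [symmetric] n_def [symmetric] a_def [symmetric] b_def [symmetric]
    by (intro pair_bilinear continuous_R continuous_S)
  show ?thesis
  proof (cases "m = n")
    case False
    \<comment> \<open>For index 0 the truncated index m - 1 or n - 1 would name the wrong S; its
      coefficient is zero.\<close>
    have a0: "a = 0" if "m = 0" using that by (simp add: m_def a_def)
    have b0: "b = 0" if "n = 0" using that by (simp add: n_def b_def)
    note orth = pair_R_R_eq_0 [OF t1] pair_R_S_eq_0 [OF t1] pair_S_S_eq_0 [OF t1]
    have "pair (R m) (R n) = 0" using orth(1) False by blast
    moreover have "b * pair (R m) (S (n - 1)) = 0"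
      using b0 orth(2) [of m "n - 1"] False by (cases n) auto
    moreover have "a * pair (S (m - 1)) (R n) = 0"
      using a0 orth(2) [of n "m - 1"] False by (cases m) (auto simp: cher_pair_commute [of _ _ _ _ _ _ "R n"])
    moreover have "a * b * pair (S (m - 1)) (S (n - 1)) = 0"
      using a0 b0 orth(3) [of "m - 1" "n - 1"] False by (cases m; cases n) auto
    ultimately show ?thesis unfolding expand by auto
  next
    case True
    then have ij: "i = - j" "j \<noteq> 0" using assms by (auto simp: m_def n_def)
    then obtain k where k: "n = Suc k" by (cases n) (auto simp: n_def)
    define \<alpha> \<beta> where "\<alpha> = - t1 * (1 - t1 * t2 * t3 * t4 * q ^ k)"
      and "\<beta> = t1\<^sup>2 * t2 * (1 - q ^ Suc k)"
    \<comment> \<open>Either of \<open>i\<close>, \<open>j\<close> may be the negative index, but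
      only the sum and the product of the two coefficients enter.\<close>
    have "a = \<alpha> \<and> b = \<beta> \<or> a = \<beta> \<and> b = \<alpha>"
      using ij k unfolding a_def b_def \<alpha>_def \<beta>_def X_coeff_def n_def by auto
    then have "a + b = \<alpha> + \<beta>" "a * b = \<alpha> * \<beta>" by auto
    moreover have "pair (X i) (X j) = A * A * pair (R (Suc k)) (R (Suc k))
      + A * (a + b) * pair (R (Suc k)) (S k) + a * b * pair (S k) (S k)"
      unfolding expand True k cher_pair_commute [of q t1 t2 t3 t4 "S _" "R _"]
      by (simp add: algebra_simps)
    ultimately show ?thesis
      using orthogonal_same_degree [OF t1, of k] by (simp add: \<alpha>_def \<beta>_def)
  qed
qed

end

context real_cher
begin

lemma A_real: "A \<in> \<real>" and X_coeff_real: "X_coeff q t1 t2 t3 t4 j \<in> \<real>"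
  using real q_real by (auto simp: aw_A_def X_coeff_def)

lemma X_in_laurent_space:
  assumes "\<bar>j\<bar> \<le> int n"
  shows "punctured (X j) \<in> laurent_space n"
proof (intro subspace_punctured_add subspace_laurent_space)
  show "punctured (\<lambda>z. A * R (nat \<bar>j\<bar>) z) \<in> laurent_space n"
    using assms by (intro subspace_punctured_scale subspace_laurent_space R_in_laurent_space A_real) auto
  show "punctured (\<lambda>z. X_coeff q t1 t2 t3 t4 j * S (nat \<bar>j\<bar> - 1) z) \<in> laurent_space n"
  proof (cases "j = 0 \<or> t1 = 0")
    \<comment> \<open>Both branches of \<open>X_coeff\<close> contain t1, so S drops out where
      \<open>S_in_laurent_space\<close> does not apply.\<close>
    case True
    then have "X_coeff q t1 t2 t3 t4 j = 0" by (auto simp: X_coeff_def)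
    then show ?thesis
      using fun_vs.subspace_0 [OF subspace_laurent_space] by (simp add: punctured_def zero_fun_def)
  next
    case False
    then show ?thesis
      using assms by (intro subspace_punctured_scale subspace_laurent_space S_in_laurent_space X_coeff_real) auto
  qed
qed

text \<open>The members with indices m + 1 and -(m + 1) differ by \<open>D\<close> times
  \<open>S m\<close>, where \<open>D\<close> is t1 times the quantity in \<open>nd\<close>. This
  recovers each S, and subtracting its multiple from X and dividing by \<open>A\<close> recovers
  each R.\<close>

lemma laurent_space_subset_X:
  assumes t1: "t1 \<noteq> 0" and W: "fun_vs.subspace W"
    and X: "\<And>j. \<bar>j\<bar> \<le> int n \<Longrightarrow> punctured (X j) \<in> W"
    and nd: "\<And>m. m < n \<Longrightarrow> 1 - t1 * t2 * t3 * t4 * q ^ m + t1 * t2 * (1 - q ^ Suc m) \<noteq> 0"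
  shows "laurent_space n \<subseteq> W"
proof (rule laurent_space_subset [OF t1 W])
  show S_in: "punctured (S m) \<in> W" if "m < n" for m
  proof -
    define D where "D = X_coeff q t1 t2 t3 t4 (int (Suc m)) - X_coeff q t1 t2 t3 t4 (- int (Suc m))"
    have "D = t1 * (1 - t1 * t2 * t3 * t4 * q ^ m + t1 * t2 * (1 - q ^ Suc m))"
      by (simp add: D_def X_coeff_def nat_add_distrib algebra_simps power2_eq_square)
    then have D: "D \<noteq> 0" using t1 nd [OF that] by simp
    have "D \<in> \<real>" unfolding D_def by (intro Reals_diff X_coeff_real)
    moreover have "punctured (\<lambda>z. X (int (Suc m)) z - X (- int (Suc m)) z) \<in> W"
      using that by (intro subspace_punctured_diff [OF W X X]) auto
    ultimately have "punctured (\<lambda>z. inverse D * (X (int (Suc m)) z - X (- int (Suc m)) z)) \<in> W"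
      by (intro subspace_punctured_scale [OF W]) auto
    also have "(\<lambda>z. inverse D * (X (int (Suc m)) z - X (- int (Suc m)) z)) = S m"
    proof
      fix z
      have "X (int (Suc m)) z - X (- int (Suc m)) z = D * S m z"
        by (simp add: D_def nat_add_distrib algebra_simps)
      then show "inverse D * (X (int (Suc m)) z - X (- int (Suc m)) z) = S m z"
        using D by simp
    qed
    finally show ?thesis .
  qed
  show "punctured (R m) \<in> W" if "m \<le> n" for m
  proof -
    let ?c = "X_coeff q t1 t2 t3 t4 (int m)"
    have cS: "punctured (\<lambda>z. ?c * S (m - 1) z) \<in> W"
    proof (cases m)
      case 0
      then show ?thesis
        using fun_vs.subspace_0 [OF W] by (simp add: punctured_def zero_fun_def)
    next
      case (Suc k)
      then show ?thesis
        using that by (intro subspace_punctured_scale [OF W S_in] X_coeff_real) auto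
    qed
    have "punctured (\<lambda>z. inverse A * (X (int m) z - ?c * S (m - 1) z)) \<in> W"
      using that A_real by (intro subspace_punctured_scale [OF W subspace_punctured_diff [OF W X cS]]) auto
    also have "(\<lambda>z. inverse A * (X (int m) z - ?c * S (m - 1) z)) = R m"
      using A_nonzero by (simp add: fun_eq_iff)
    finally show ?thesis .
  qed
qed

end

theorem theorem4p4:
  fixes t1 t2 t3 t4 q :: real and n :: nat
  assumes "0 < q" "q < 1"
    and "\<bar>t1\<bar> < 1" "\<bar>t2\<bar> < 1" "\<bar>t3\<bar> < 1" "\<bar>t4\<bar> < 1"
  shows "pairwise_orthogonal (cher_form t1 t2 t3 t4 q) {- int n..int n} (cher_X t1 t2 t3 t4 q) \<and>
         cher_X t1 t2 t3 t4 q ` {- int n..int n} \<subseteq> laurent_space n \<and>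
         (nondegenerate t1 t2 t3 t4 q n \<longrightarrow>
          orthogonal_basis (cher_form t1 t2 t3 t4 q) (laurent_space n)
            {- int n..int n} (cher_X t1 t2 t3 t4 q))"
proof -
  interpret real_cher "sqrt q" "of_real (sqrt q)" "of_real q"
    "of_real t1" "of_real t2" "of_real t3" "of_real t4"
    by unfold_locales (use assms in \<open>auto simp flip: of_real_mult\<close>)
  have X_eq: "cher_X t1 t2 t3 t4 q j = punctured (X j)" for j
    by (rule cher_X_eq [OF assms(1)])
  \<comment> \<open>The integral only sees the unit circle, where puncturing at the origin changes
    nothing.\<close>
  have form: "cher_form t1 t2 t3 t4 q (punctured f) (punctured g) = pair f g" for f g
    unfolding cher_form_circ_mean cher_pair_def
    by (rule circ_mean_cong) (auto simp: punctured_def w_cher_eq)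
  have orth: "pairwise_orthogonal (cher_form t1 t2 t3 t4 q) {- int n..int n} (cher_X t1 t2 t3 t4 q)"
    unfolding pairwise_orthogonal_def X_eq form using X_orthogonal by blast
  have sub: "cher_X t1 t2 t3 t4 q ` {- int n..int n} \<subseteq> laurent_space n"
    using X_in_laurent_space [of _ n] by (auto simp: X_eq)
  have "orthogonal_basis (cher_form t1 t2 t3 t4 q) (laurent_space n)
            {- int n..int n} (cher_X t1 t2 t3 t4 q)" if nd: "nondegenerate t1 t2 t3 t4 q n"
  proof -
    let ?W = "fun_vs.span (cher_X t1 t2 t3 t4 q ` {- int n..int n})"
    have X_in: "punctured (X j) \<in> ?W" if "\<bar>j\<bar> \<le> int n" for j
      using that unfolding X_eq [symmetric] by (intro fun_vs.span_base imageI) auto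
    have "laurent_space n \<subseteq> ?W"
    proof (cases n)
      \<comment> \<open>For n = 0 \<open>nondegenerate\<close> is vacuous and gives no information
        on t1; the space is spanned directly by \<open>X 0\<close>, the nonzero constant
        \<open>A\<close>.\<close>
      case 0
      have "punctured (\<lambda>z. 1) = punctured (\<lambda>z. inverse A * X 0 z)"
        by (rule punctured_cong) (use A_nonzero in simp)
      also have "\<dots> \<in> ?W"
        using A_real by (intro subspace_punctured_scale fun_vs.subspace_span X_in) auto
      finally show ?thesis
        unfolding laurent_space_def 0 by (intro fun_vs.span_minimal) (auto simp: 0)
    next
      case (Suc k)
      show ?thesis
      proof (rule laurent_space_subset_X [OF _ fun_vs.subspace_span X_in])
        show "complex_of_real t1 \<noteq> 0"
          using nd Suc by (auto simp: nondegenerate_def)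
        fix m assume "m < n"
        \<comment> \<open>This is \<open>nondegenerate\<close> at index m + 1, which lies in
          {1..n}.\<close>
        then have "1 - t1 * t2 * t3 * t4 * q ^ m + t1 * t2 * (1 - q ^ Suc m) \<noteq> 0"
          using nd unfolding nondegenerate_def
          by (metis One_nat_def Suc_leI atLeastAtMost_iff diff_Suc_1 le_numeral_extra(4) not_less_eq_eq zero_le)
        then have "complex_of_real (1 - t1 * t2 * t3 * t4 * q ^ m + t1 * t2 * (1 - q ^ Suc m)) \<noteq> 0"
          by (simp only: of_real_eq_0_iff not_False_eq_True)
        then show "1 - complex_of_real t1 * of_real t2 * of_real t3 * of_real t4 * of_real q ^ m
          + of_real t1 * of_real t2 * (1 - of_real q ^ Suc m) \<noteq> 0"
          by simp
      qed
    qed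
    with spanning_family_is_basis [OF sub] orth show ?thesis
      by (simp add: orthogonal_basis_def)
  qed
  with orth sub show ?thesis by blast
qed

end
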